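(* Consider the nearest-neighbour random walk $X(t)=X(t;\omega,0)$ on $\mathbb{Z}$ in random environment described in the context, and suppose that Condition $\mathbf{C}'$ (see context) is satisfied, that $\lambda<0$ and that $r(2)<1$. Suppose that the environment is uniformly ergodic (see context). Let $\sigma^*=\sqrt{\mu^{-3}\sigma^2}$ and let $\tilde b(t)=\tilde b(t;\omega)$ be the implicit centering defined in the context. Then $$\lim_{t\to\infty}t^{-\frac12}\sum_{k=\tilde b(t)}^{\tilde b(t)+\sqrt{t}\,\sigma^*x}(\mu_k-\mu)=0\quad\text{with $\mathbb{P}$-probability 1 for any real $x$,}$$ and thus for $\mathbb{P}$-almost every environment $\omega$ $$\lim_{t\to\infty}Pr_\omega\left\{\frac{X(t)-\tilde b(t)}{\sqrt{t}\,\sigma^*}\le x\right\}=\Phi(x)$$ and the convergence is uniform in $x\in\mathbb{R}$.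
   Context: Environment and walk. $(\Omega,\mathcal{F},\mathbb{P})$ is a probability space, $\mathcal{T}:\Omega\to\Omega$ is an invertible transformation preserving $\mathbb{P}$, and $p:\Omega\to(0,1)$ is measurable. Put $p_n=p_n(\omega)=p(\mathcal{T}^n\omega)$, $q_n=1-p_n$, $A_n=q_n/p_n$, $n\in\mathbb{Z}$. For fixed $\omega$, $X(t;\omega,z)$, $t=0,1,2,\dots$, is the Markov chain on $\mathbb{Z}$ started at $z$ which jumps from $n$ to $n+1$ with probability $p_n$ and from $n$ to $n-1$ with probability $q_n$. $Pr_\omega$ is the law of the walk for the fixed (quenched) environment $\omega$ (started at $0$ unless said otherwise), $\mathrm{Var}_\omega$ is the variance with respect to it, and $\mathbb{E}$ is the expectation with respect to $\mathbb{P}$. $\tau_k$ denotes the hitting time of $k+1$ by the walk started at $k$. Condition $\mathbf{C}'$: (C1) the dynamical system $(\Omega,\mathcal{F},\mathbb{P},\mathcal{T})$ is ergodic; (C3) there is $\gamma>2$ such that $\mathbb{E}p_k^{-\gamma}<\infty$ and $\mathbb{E}(1-p_k)^{-\gamma}<\infty$; (C4) $\limsup_{n\to\infty}\big(\mathbb{E}\prod_{j=1}^n (q_j/p_j)^\gamma\big)^{1/n}<\infty$. Notation. $\lambda=\mathbb{E}\ln A_j$ (independent of $j$). For $\kappa\in[0,\gamma]$, $r(\kappa)=\limsup_{n\to\infty}\big(\mathbb{E}\prod_{j=1}^nA_j^\kappa\big)^{1/n}$. $\mu_k=\mu_k(\omega)=\mu_0(\mathcal{T}^k\omega)=1+2\sum_{j=0}^\infty\prod_{i=k-j}^kA_i$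 and $\mu=\mathbb{E}\mu_k$ (finite under the assumptions). $\sigma^2=\mathbb{E}\,\mathrm{Var}_\omega(\tau_k)$ (independent of $k$). $H(n)=H(n,\omega)=\sum_{k=0}^{n-1}\mu_k$ for integers $n\ge0$. Implicit centering: $\tilde b(t;\omega)$ is the integer such that $H(\tilde b(t;\omega))\le t<H(\tilde b(t;\omega)+1)$. Uniform ergodicity: for an $\mathcal{F}$-measurable $f:\Omega\to\mathbb{R}$, $\mathcal{T}$ is $f$-uniformly ergodic if there is a sequence $\varepsilon_n\to0$, not depending on $\omega$, such that $\big|n^{-1}\sum_{j=1}^nf(\mathcal{T}^j\omega)-\mathbb{E}f\big|\le\varepsilon_n$ for all $\omega$ and $n$. The environment is called uniformly ergodic if $\mathcal{T}$ is $\mu_0$-uniformly ergodic. Summation convention: $\lfloor y\rfloor$ is the integer part of $y$; for real $b_1,b_2$, $\sum_{k=b_1}^{b_2}d_k$ means $\sum_{k=\lfloor b_1\rfloor}^{\lfloor b_2\rfloor}d_k$ if $\lfloor b_1\rfloor\le\lfloor b_2\rfloor$, and $-\sum_{k=\lfloor b_2\rfloor}^{\lfloor b_1\rfloor}d_k$ if $\lfloor b_2\rfloor<\lfloor b_1\rfloor$. $\Phi(x)=\frac1{\sqrt{2\pi}}\int_{-\infty}^xe^{-u^2/2}du$. *)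

theory Defs
  imports "HOL-Probability.Probability"
begin

section \<open>Stationary environments\<close>

locale random_environment = prob_space M for M :: "'w measure" +
  fixes T :: "'w \<Rightarrow> 'w" and p :: "'w \<Rightarrow> real"
  assumes bij_T: "bij_betw T (space M) (space M)"
    and measurable_T: "T \<in> M \<rightarrow>\<^sub>M M"
    and measurable_inv_T: "inv_into (space M) T \<in> M \<rightarrow>\<^sub>M M"
    and preserving_T: "distr M M T = M"
    and measurable_p: "p \<in> borel_measurable M"
    and p_range: "\<And>\<omega>. \<omega> \<in> space M \<Longrightarrow> p \<omega> \<in> {0<..<1}"

definition ergodic :: "'w measure \<Rightarrow> ('w \<Rightarrow> 'w) \<Rightarrow> bool" where
  "ergodic M T \<longleftrightarrow>
     (\<forall>B\<in>sets M. T -` B \<inter> space M = B \<longrightarrow> measure M B = 0 \<or> measure M B = 1)"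

definition iterate :: "'w measure \<Rightarrow> ('w \<Rightarrow> 'w) \<Rightarrow> int \<Rightarrow> 'w \<Rightarrow> 'w" where
  "iterate M T n = (if 0 \<le> n then T ^^ nat n else inv_into (space M) T ^^ nat (- n))"

definition env_p :: "'w measure \<Rightarrow> ('w \<Rightarrow> 'w) \<Rightarrow> ('w \<Rightarrow> real) \<Rightarrow> 'w \<Rightarrow> int \<Rightarrow> real" where
  "env_p M T p \<omega> n = p (iterate M T n \<omega>)"

definition env_A :: "'w measure \<Rightarrow> ('w \<Rightarrow> 'w) \<Rightarrow> ('w \<Rightarrow> real) \<Rightarrow> 'w \<Rightarrow> int \<Rightarrow> real" where
  "env_A M T p \<omega> n = (1 - env_p M T p \<omega> n) / env_p M T p \<omega> n"

text \<open>The expectations inside the limsup below may be infinite, so everything is kept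
  in \<^typ>\<open>ennreal\<close>; the \<open>n\<close>-th root is only relevant for \<open>n \<ge> 1\<close>.\<close>

definition ennreal_root :: "nat \<Rightarrow> ennreal \<Rightarrow> ennreal" where
  "ennreal_root n x = (if x = \<top> then \<top> else ennreal (root n (enn2real x)))"

definition env_r :: "'w measure \<Rightarrow> ('w \<Rightarrow> 'w) \<Rightarrow> ('w \<Rightarrow> real) \<Rightarrow> real \<Rightarrow> ennreal" where
  "env_r M T p \<kappa> = limsup (\<lambda>n. ennreal_root n
     (\<integral>\<^sup>+\<omega>. ennreal (\<Prod>j\<in>{1..int n}. env_A M T p \<omega> j powr \<kappa>) \<partial>M))"

definition condition_C' :: "'w measure \<Rightarrow> ('w \<Rightarrow> 'w) \<Rightarrow> ('w \<Rightarrow> real) \<Rightarrow> bool" where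
  "condition_C' M T p \<longleftrightarrow> ergodic M T \<and>
     (\<exists>\<gamma>>2.
        (\<forall>k. (\<integral>\<^sup>+\<omega>. ennreal (env_p M T p \<omega> k powr (- \<gamma>)) \<partial>M) < \<infinity>) \<and>
        (\<forall>k. (\<integral>\<^sup>+\<omega>. ennreal ((1 - env_p M T p \<omega> k) powr (- \<gamma>)) \<partial>M) < \<infinity>) \<and>
        env_r M T p \<gamma> < \<infinity>)"

text \<open>By stationarity the annealed constants \<open>env_lambda\<close>, \<open>env_mean_mu\<close> and \<open>env_sigma2\<close>
  (below) do not depend on the site; site \<open>0\<close> is used.\<close>

definition env_lambda :: "'w measure \<Rightarrow> ('w \<Rightarrow> 'w) \<Rightarrow> ('w \<Rightarrow> real) \<Rightarrow> real" where
  "env_lambda M T p = (\<integral>\<omega>. ln (env_A M T p \<omega> 0) \<partial>M)"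

definition mu_term :: "'w measure \<Rightarrow> ('w \<Rightarrow> 'w) \<Rightarrow> ('w \<Rightarrow> real) \<Rightarrow> 'w \<Rightarrow> int \<Rightarrow> nat \<Rightarrow> real" where
  "mu_term M T p \<omega> k j = (\<Prod>i\<in>{k - int j..k}. env_A M T p \<omega> i)"

definition env_mu :: "'w measure \<Rightarrow> ('w \<Rightarrow> 'w) \<Rightarrow> ('w \<Rightarrow> real) \<Rightarrow> 'w \<Rightarrow> int \<Rightarrow> real" where
  "env_mu M T p \<omega> k = 1 + 2 * (\<Sum>j. mu_term M T p \<omega> k j)"

definition env_mean_mu :: "'w measure \<Rightarrow> ('w \<Rightarrow> 'w) \<Rightarrow> ('w \<Rightarrow> real) \<Rightarrow> real" where
  "env_mean_mu M T p = (\<integral>\<omega>. env_mu M T p \<omega> 0 \<partial>M)"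

definition uniformly_ergodic_for :: "'w measure \<Rightarrow> ('w \<Rightarrow> 'w) \<Rightarrow> ('w \<Rightarrow> real) \<Rightarrow> bool" where
  "uniformly_ergodic_for M T f \<longleftrightarrow> f \<in> borel_measurable M \<and>
     (\<exists>\<epsilon> :: nat \<Rightarrow> real. \<epsilon> \<longlonglongrightarrow> 0 \<and>
        (\<forall>\<omega>\<in>space M. \<forall>n\<ge>1.
           \<bar>(\<Sum>j=1..n. f ((T ^^ j) \<omega>)) / real n - (\<integral>\<omega>'. f \<omega>' \<partial>M)\<bar> \<le> \<epsilon> n))"

text \<open>The definition above is for real-valued functions. The series defining \<open>\<mu>\<^sub>0\<close> has positive
  terms, so \<open>\<mu>\<^sub>0\<close> being real-valued on the whole of \<open>\<Omega>\<close> means that the series converges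
  everywhere. (If \<open>\<mu>\<^sub>0 = \<infinity>\<close> were allowed somewhere, the bound with finite \<open>\<epsilon>\<^sub>n\<close> for every
  \<open>\<omega>\<close> would exclude it.)\<close>

definition uniformly_ergodic_env :: "'w measure \<Rightarrow> ('w \<Rightarrow> 'w) \<Rightarrow> ('w \<Rightarrow> real) \<Rightarrow> bool" where
  "uniformly_ergodic_env M T p \<longleftrightarrow>
     (\<forall>\<omega>\<in>space M. summable (mu_term M T p \<omega> 0)) \<and>
     uniformly_ergodic_for M T (\<lambda>\<omega>. env_mu M T p \<omega> 0)"


section \<open>The quenched walk\<close>

text \<open>For a fixed environment \<open>a\<close> (\<open>a n\<close> is the probability of a jump from \<open>n\<close> to \<open>n + 1\<close>) the
  law of the walk started at \<open>z\<close> is the measure on path space given by the Ionescu-Tulcea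
  theorem; \<open>X(t)\<close> is the coordinate map \<open>\<lambda>x. x t\<close>.\<close>

definition walk_step :: "(int \<Rightarrow> real) \<Rightarrow> int \<Rightarrow> int pmf" where
  "walk_step a n = map_pmf (\<lambda>right. if right then n + 1 else n - 1) (bernoulli_pmf (a n))"

definition walk_kernel :: "(int \<Rightarrow> real) \<Rightarrow> int \<Rightarrow> nat \<Rightarrow> (nat \<Rightarrow> int) \<Rightarrow> int measure" where
  "walk_kernel a z t x =
     measure_pmf (case t of 0 \<Rightarrow> return_pmf z | Suc s \<Rightarrow> walk_step a (x s))"

global_interpretation walk: Ionescu_Tulcea "walk_kernel a z" "\<lambda>_. count_space (UNIV :: int set)"
  for a :: "int \<Rightarrow> real" and z :: int
  defines walk_law = walk.PF.lim
proof (rule Ionescu_Tulcea.intro)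
  have *: "measure_pmf q \<in> space (subprob_algebra (count_space UNIV))" for q :: "int pmf"
    by (rule measure_pmf_in_subprob_algebra)
  show "walk_kernel a z i \<in>
      PiM {0..<i} (\<lambda>_. count_space UNIV) \<rightarrow>\<^sub>M subprob_algebra (count_space UNIV)" for i
  proof (cases i)
    case 0
    then show ?thesis
      by (auto simp: walk_kernel_def[abs_def] intro!: measurable_const *)
  next
    case (Suc s)
    have "(\<lambda>x. x s) \<in> PiM {0..<Suc s} (\<lambda>_. count_space UNIV) \<rightarrow>\<^sub>M
        count_space (UNIV :: int set)"
      by (rule measurable_component_singleton) simp
    moreover have "(\<lambda>v. measure_pmf (walk_step a v)) \<in>
        count_space UNIV \<rightarrow>\<^sub>M subprob_algebra (count_space UNIV)"
      using * by auto
    ultimately have "(\<lambda>x. measure_pmf (walk_step a (x s))) \<in>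
        PiM {0..<Suc s} (\<lambda>_. count_space UNIV) \<rightarrow>\<^sub>M subprob_algebra (count_space UNIV)"
      by (rule measurable_compose)
    with Suc show ?thesis by (simp add: walk_kernel_def[abs_def])
  qed
  show "prob_space (walk_kernel a z i x)" for i x
    unfolding walk_kernel_def by (rule prob_space_measure_pmf)
qed

text \<open>The hitting time is infinite if the site is never hit.\<close>

definition hitting_time :: "int \<Rightarrow> (nat \<Rightarrow> int) \<Rightarrow> enat" where
  "hitting_time m x = (INF t\<in>{t. x t = m}. enat t)"

text \<open>\<open>Var\<^sub>\<omega>(\<tau>\<^sub>k)\<close>. The conversion to \<^typ>\<open>real\<close> sends \<open>\<infinity>\<close> to \<open>0\<close>; this is harmless because
  for \<open>\<lambda> < 0\<close> the hitting times are finite with probability 1 in almost every environment.\<close>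

definition var_tau :: "(int \<Rightarrow> real) \<Rightarrow> int \<Rightarrow> real" where
  "var_tau a k = prob_space.variance (walk_law a k)
     (\<lambda>x. real_of_ereal (ereal_of_enat (hitting_time (k + 1) x)))"

definition env_sigma2 :: "'w measure \<Rightarrow> ('w \<Rightarrow> 'w) \<Rightarrow> ('w \<Rightarrow> real) \<Rightarrow> real" where
  "env_sigma2 M T p = (\<integral>\<omega>. var_tau (env_p M T p \<omega>) 0 \<partial>M)"

definition sigma_star :: "'w measure \<Rightarrow> ('w \<Rightarrow> 'w) \<Rightarrow> ('w \<Rightarrow> real) \<Rightarrow> real" where
  "sigma_star M T p = sqrt (env_sigma2 M T p / env_mean_mu M T p ^ 3)"


section \<open>The implicit centering\<close>

definition env_H :: "'w measure \<Rightarrow> ('w \<Rightarrow> 'w) \<Rightarrow> ('w \<Rightarrow> real) \<Rightarrow> 'w \<Rightarrow> nat \<Rightarrow> real" where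
  "env_H M T p \<omega> n = (\<Sum>k<n. env_mu M T p \<omega> (int k))"

definition b_tilde :: "'w measure \<Rightarrow> ('w \<Rightarrow> 'w) \<Rightarrow> ('w \<Rightarrow> real) \<Rightarrow> 'w \<Rightarrow> nat \<Rightarrow> nat" where
  "b_tilde M T p \<omega> t =
     (THE b. env_H M T p \<omega> b \<le> real t \<and> real t < env_H M T p \<omega> (b + 1))"

text \<open>Sums with real limits. Both end points are included also in the reversed case.\<close>

definition real_sum :: "(int \<Rightarrow> real) \<Rightarrow> real \<Rightarrow> real \<Rightarrow> real" where
  "real_sum d b1 b2 =
     (if \<lfloor>b1\<rfloor> \<le> \<lfloor>b2\<rfloor> then (\<Sum>k\<in>{\<lfloor>b1\<rfloor>..\<lfloor>b2\<rfloor>}. d k) else - (\<Sum>k\<in>{\<lfloor>b2\<rfloor>..\<lfloor>b1\<rfloor>}. d k))"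

definition Phi :: "real \<Rightarrow> real" where
  "Phi x = 1 / sqrt (2 * pi) * (LBINT u:{..x}. exp (- u\<^sup>2 / 2))"


section \<open>Consistency of the definitions\<close>

lemma space_walk_law [simp]: "space (walk_law a z) = UNIV"
  using walk.PF.space_lim[of a z] by (simp add: space_PiM)

lemma sets_walk_law [measurable_cong]:
  "sets (walk_law a z) = sets (PiM UNIV (\<lambda>_. count_space UNIV))"
  by (rule walk.PF.sets_lim)

lemma pmf_walk_step:
  assumes "0 \<le> a n" "a n \<le> 1"
  shows "pmf (walk_step a n) (n + 1) = a n" "pmf (walk_step a n) (n - 1) = 1 - a n"
proof -
  have "(\<lambda>right. if right then n + 1 else n - 1) -` {n + 1} = {True}"
    "(\<lambda>right. if right then n + 1 else n - 1) -` {n - 1} = {False}"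
    by (auto split: if_splits)
  with assms show "pmf (walk_step a n) (n + 1) = a n" "pmf (walk_step a n) (n - 1) = 1 - a n"
    by (simp_all add: walk_step_def pmf_map measure_pmf_single)
qed

lemma walk_law_cylinder:
  "emeasure (walk_law a z) {x. \<forall>i\<le>t. x i = y i} =
     ennreal (indicator {z} (y 0) * (\<Prod>i<t. pmf (walk_step a (y i)) (y (Suc i))))"
proof -
  let ?M = "\<lambda>_::nat. count_space (UNIV :: int set)"
  let ?E = "\<lambda>n. PiE {0..<n} (\<lambda>i. {y i})"
  have u: "(\<lambda>_. undefined) \<in> space (PiM {0..<0} ?M)"
    by (simp add: space_PiM)
  have setsE: "?E n \<in> sets (PiM {0..<n} ?M)" for n
    by (intro sets_PiM_I_finite) auto
  have C: "emeasure (walk.C a z 0 (Suc t) (\<lambda>_. undefined)) (?E (Suc t)) =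
     ennreal (indicator {z} (y 0) * (\<Prod>i<t. pmf (walk_step a (y i)) (y (Suc i))))" for t
  proof -
    have step: "emeasure (walk.C a z 0 (Suc n) (\<lambda>_. undefined)) (?E (Suc n)) =
        emeasure (walk.C a z 0 n (\<lambda>_. undefined)) (?E n) *
        emeasure (walk_kernel a z n y) {y n}" for n
    proof -
      have "emeasure (walk.C a z 0 (Suc n) (\<lambda>_. undefined)) (?E (Suc n)) =
        (\<integral>\<^sup>+ x. emeasure (walk.eP a z n x) (?E (Suc n)) \<partial>walk.C a z 0 n (\<lambda>_. undefined))"
      proof -
        have "walk.eP a z n \<in> PiM {0..<0 + n} ?M \<rightarrow>\<^sub>M subprob_algebra (PiM {0..<Suc n} ?M)"
          using walk.measurable_eP[of a z n] by simp
        then have "walk.eP a z n \<in>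
            walk.C a z 0 n (\<lambda>_. undefined) \<rightarrow>\<^sub>M subprob_algebra (PiM {0..<Suc n} ?M)"
          by (subst measurable_cong_sets[OF walk.sets_C[OF u] refl])
        moreover have "space (walk.C a z 0 n (\<lambda>_. undefined)) \<noteq> {}"
          using walk.space_C[OF u, of a z n] by (simp add: space_PiM PiE_eq_empty_iff)
        ultimately show ?thesis
          using setsE[of "Suc n"] by (simp add: emeasure_bind)
      qed
      also have "\<dots> = (\<integral>\<^sup>+ x. emeasure (walk_kernel a z n y) {y n} * indicator (?E n) x
          \<partial>walk.C a z 0 n (\<lambda>_. undefined))"
      proof (rule nn_integral_cong)
        fix x assume "x \<in> space (walk.C a z 0 n (\<lambda>_. undefined))"
        then have x: "x \<in> space (PiM {0..<n} ?M)"
          using walk.space_C[OF u] by simp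
        then have ext: "x \<in> extensional {0..<n}"
          by (auto simp: space_PiM PiE_iff)
        have mem: "x(n := v) \<in> ?E (Suc n) \<longleftrightarrow> x \<in> ?E n \<and> v = y n" for v
        proof -
          have "x(n := v) \<in> extensional {0..<Suc n}"
            using ext by (auto simp: extensional_def)
          then show ?thesis
            using ext by (auto simp: PiE_iff less_Suc_eq split: if_splits)
        qed
        have ker: "walk_kernel a z n x = walk_kernel a z n y" if "x \<in> ?E n"
          using that by (cases n) (auto simp: walk_kernel_def PiE_iff)
        have "emeasure (walk.eP a z n x) (?E (Suc n)) =
            emeasure (walk_kernel a z n x) ((\<lambda>v. x(n := v)) -` ?E (Suc n))"
          using walk.emeasure_eP[OF x setsE, of a z] by simp
        also have "(\<lambda>v. x(n := v)) -` ?E (Suc n) = (if x \<in> ?E n then {y n} else {})"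
          using mem by auto
        finally show "emeasure (walk.eP a z n x) (?E (Suc n)) =
            emeasure (walk_kernel a z n y) {y n} * indicator (?E n) x"
          using ker by (auto split: split_indicator)
      qed
      also have "\<dots> = emeasure (walk_kernel a z n y) {y n} *
          emeasure (walk.C a z 0 n (\<lambda>_. undefined)) (?E n)"
        using setsE[of n] walk.sets_C[OF u, of a z n]
        by (intro nn_integral_cmult_indicator) simp
      finally show ?thesis by (simp add: mult.commute)
    qed
    have kernel_0: "emeasure (walk_kernel a z 0 y) {y 0} = ennreal (indicator {z} (y 0))"
      by (simp add: walk_kernel_def emeasure_pmf_single split: split_indicator)
    have kernel_Suc: "emeasure (walk_kernel a z (Suc n) y) {y (Suc n)} =
        ennreal (pmf (walk_step a (y n)) (y (Suc n)))" for n
      by (simp add: walk_kernel_def emeasure_pmf_single)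
    show ?thesis
    proof (induction t)
      case 0
      have "emeasure (walk.C a z 0 0 (\<lambda>_. undefined)) (?E 0) = 1"
        using setsE[of 0] by simp
      then show ?case
        using step[of 0] by (simp only: kernel_0) simp
    next
      case (Suc t)
      show ?case
        by (simp only: step[of "Suc t"] Suc.IH kernel_Suc)
          (simp add: prod_nonneg mult.assoc flip: ennreal_mult)
    qed
  qed
  have "{x. \<forall>i\<le>t. x i = y i} = prod_emb UNIV ?M {0..<Suc t} (?E (Suc t))"
    by (auto simp: prod_emb_def space_PiM PiE_iff less_Suc_eq_le)
  then have "emeasure (walk_law a z) {x. \<forall>i\<le>t. x i = y i} =
      emeasure (walk.CI a z {0..<Suc t}) (?E (Suc t))"
    using walk.lim[OF _ setsE[of "Suc t"], of a z] by simp
  also have "\<dots> = emeasure (walk.C a z 0 (Suc t) (\<lambda>_. undefined)) (?E (Suc t))"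
    using walk.emeasure_CI[OF order.refl setsE[of "Suc t"], of a z]
    by (simp add: prod_emb_id del: walk.C.simps)
  finally show ?thesis using C by simp
qed

end

(* Uniform ergodicity bounds mu_0 on the whole of Omega, because T is onto and the estimate with
   n = 1 controls mu_0 o T.  With H extended to all integers, M(t) = H(X(t)) - t is then a quenched
   martingale with bounded increments, and the equation p_k g_k - q_k g_{k-1} = v_k, where v_k is
   the variance of a step of M from k, has the bounded solution g_k = Var(tau_k).  Let G be the
   primitive of g.  The process exp(i u M(t) + u^2 G(X(t)) / 2) is a martingale up to errors of
   order u^3 per step, so for u = theta / sqrt t its expectation at time t tends to 1.  By
   Birkhoff's theorem G(n) / H(n) tends to sigma^2 / mu, hence G(X(t)) / t tends to sigma^2 / mu in
   mean, and M(t) / sqrt t is asymptotically normal with variance sigma^2 / mu.  Uniform ergodicity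
   also replaces H(X(t)) - H(b(t)) by mu (X(t) - b(t)) up to o(sqrt t), which gives the limit law;
   the uniformity in x is Polya's theorem. *)

theory Submission
  imports Defs
begin

text \<open>A direct martingale central limit theorem would need a law of large numbers for the
  variances \<open>v\<close> collected along the trajectory, hence for the environment seen from the
  walk. As the mean increment of \<open>G\<close> at each site is \<open>v\<close>,
  \<open>G(X(t))\<close> equals that sum up to a martingale, and ergodicity in space at the end
  point suffices. Birkhoff controls \<open>G\<close> only to the right of the origin; to the left,
  the distance from the origin is at most the deviation of \<open>H(X(t))\<close> from
  \<open>t\<close>, whose mean is of order \<open>sqrt t\<close>. The same moment bound makes the
  linearization error negligible: uniform ergodicity gives one error
  \<open>\<delta> * length + K\<close> for all windows, and the window between \<open>b(t)\<close>
  and \<open>X(t)\<close> has mean length of order \<open>sqrt t\<close>. Linearization divides the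
  standard deviation \<open>sqrt (sigma^2 / mu)\<close> by \<open>mu\<close>, which produces
  \<open>sigma_star\<close>. Since \<open>sigma^2\<close> is defined through hitting times,
  \<open>g\<close> has to be tied to it separately: optional stopping is applied to \<open>M\<close>
  and to the compensated square \<open>M^2 - G\<close>, with an exponential weight controlling the
  paths that have not yet hit.\<close>

section \<open>The ergodic theorem and Polya's theorem\<close>

text \<open>The maxima \<open>R\<^sub>n = max 0 S\<^sub>1 \<dots> S\<^sub>n\<close> of the ergodic sums satisfy
  \<open>R\<^sub>n\<^sub>+\<^sub>1 - R\<^sub>n \<circ> T = max (- R\<^sub>n \<circ> T) f\<close>, which has a nonnegative integral and tends to \<open>f\<close>
  wherever the ergodic sums are unbounded.\<close>

lemma birkhoff_bounded_above:
  fixes f :: "'w \<Rightarrow> real"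
  assumes "prob_space M" and T [measurable]: "T \<in> M \<rightarrow>\<^sub>M M" and pres: "distr M M T = M"
    and erg: "ergodic M T" and int: "integrable M f" and neg: "(\<integral>\<omega>. f \<omega> \<partial>M) < 0"
  shows "AE \<omega> in M. \<exists>K. \<forall>n. (\<Sum>k<n. f ((T ^^ k) \<omega>)) \<le> K"
proof -
  interpret prob_space M by fact
  define S where "S n \<omega> = (\<Sum>k<n. f ((T ^^ k) \<omega>))" for n \<omega>
  have f [measurable]: "f \<in> borel_measurable M" using int by auto
  have Tk [measurable]: "(T ^^ k) \<in> M \<rightarrow>\<^sub>M M" for k
    by (induction k) (auto simp: comp_def intro: measurable_compose)
  have S_m [measurable]: "S n \<in> borel_measurable M" for n
    unfolding S_def[abs_def] by measurable
  have S_Suc: "S (Suc n) \<omega> = f \<omega> + S n (T \<omega>)" for n \<omega>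
    unfolding S_def by (subst sum.lessThan_Suc_shift) (simp add: funpow_swap1)
  \<comment> \<open>Passing from \<omega> to \<open>T \<omega>\<close> changes the sums only by the
    term \<open>f \<omega>\<close>, so their unboundedness is an invariant event; ergodicity leaves
    probability 0 or 1, and 1 is refuted.\<close>
  define B where "B = {\<omega> \<in> space M. \<forall>K::nat. \<exists>n. S n \<omega> > real K}"
  have B [measurable]: "B \<in> sets M" unfolding B_def by measurable
  have TinM: "T \<omega> \<in> space M" if "\<omega> \<in> space M" for \<omega> using that T by (rule measurable_space[rotated])
  have inv: "T -` B \<inter> space M = B"
  proof (intro equalityI subsetI)
    fix \<omega> assume "\<omega> \<in> T -` B \<inter> space M"
    then have w: "\<omega> \<in> space M" "\<And>K::nat. \<exists>n. S n (T \<omega>) > real K" by (auto simp: B_def)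
    have "\<exists>n. S n \<omega> > real K" for K :: nat
    proof -
      obtain K' :: nat where "real K - f \<omega> \<le> real K'" using real_arch_simple by blast
      moreover obtain n where "S n (T \<omega>) > real K'" using w by blast
      ultimately have "S (Suc n) \<omega> > real K" by (simp add: S_Suc)
      then show ?thesis by blast
    qed
    with w show "\<omega> \<in> B" by (auto simp: B_def)
  next
    fix \<omega> assume "\<omega> \<in> B"
    then have w: "\<omega> \<in> space M" "\<And>K::nat. \<exists>n. S n \<omega> > real K" by (auto simp: B_def)
    have "\<exists>n. S n (T \<omega>) > real K" for K :: nat
    proof -
      \<comment> \<open>The maximum with 0 rules out \<open>n = 0\<close>, whose sum is 0, so that
        \<open>S_Suc\<close> can be read backwards.\<close>
      obtain K' :: nat where K': "max (real K + f \<omega>) 0 \<le> real K'" using real_arch_simple by blast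
      obtain n where n: "S n \<omega> > real K'" using w by blast
      with K' have "n \<noteq> 0" by (auto simp: S_def intro!: Nat.gr0I)
      then obtain n' where "n = Suc n'" by (cases n) auto
      with n K' have "S n' (T \<omega>) > real K" by (simp add: S_Suc)
      then show ?thesis by blast
    qed
    with w TinM show "\<omega> \<in> T -` B \<inter> space M" by (auto simp: B_def)
  qed
  have B01: "measure M B = 0 \<or> measure M B = 1"
    using erg inv B by (auto simp: ergodic_def)
  have "measure M B \<noteq> 1"
  proof
    assume 1: "measure M B = 1"
    then have AEB: "AE \<omega> in M. \<omega> \<in> B" using prob_eq_1[OF B] by simp
    define R where "R n \<omega> = Max ((\<lambda>k. S k \<omega>) ` {..n})" for n \<omega>
    have R_m [measurable]: "R n \<in> borel_measurable M" for n
      unfolding R_def[abs_def] by measurable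
    have R_Suc: "R (Suc n) \<omega> = max 0 (f \<omega> + R n (T \<omega>))" for n \<omega>
    proof -
      have "(\<lambda>k. S k \<omega>) ` {..Suc n} = insert 0 ((\<lambda>x. f \<omega> + x) ` (\<lambda>k. S k (T \<omega>)) ` {..n})"
        by (simp add: atMost_Suc_eq_insert_0 image_image S_Suc) (simp add: S_def)
      moreover have "Max ((\<lambda>x. f \<omega> + x) ` (\<lambda>k. S k (T \<omega>)) ` {..n})
          = f \<omega> + Max ((\<lambda>k. S k (T \<omega>)) ` {..n})"
        by (rule mono_Max_commute[symmetric]) (auto simp: mono_def)
      ultimately show ?thesis by (simp add: R_def Max_insert)
    qed
    have R_mono: "R n \<omega> \<le> R (Suc n) \<omega>" for n \<omega>
      unfolding R_def by (rule Max_mono) auto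
    have R_ge0: "0 \<le> R n \<omega>" for n \<omega>
    proof -
      have "S 0 \<omega> \<le> R n \<omega>" unfolding R_def by (intro Max_ge) auto
      then show ?thesis by (simp add: S_def)
    qed
    have int_T: "integrable M h \<Longrightarrow> integrable M (\<lambda>\<omega>. h (T \<omega>))" for h :: "'w \<Rightarrow> real"
      using integrable_distr_eq[OF T, of h] by (simp add: pres)
    have R_int: "integrable M (R n)" for n
    proof (induction n)
      case 0
      have "R 0 = (\<lambda>_. 0)" by (auto simp: R_def S_def)
      then show ?case by simp
    next
      case (Suc n)
      have "integrable M (\<lambda>\<omega>. max 0 (f \<omega> + R n (T \<omega>)))"
        using int int_T[OF Suc] by auto
      then show ?case by (simp add: R_Suc[abs_def])
    qed
    have eq: "R (Suc n) \<omega> - R n (T \<omega>) = max (- R n (T \<omega>)) (f \<omega>)" for n \<omega>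
      by (simp add: R_Suc max_def)
    have pos: "0 \<le> (\<integral>\<omega>. max (- R n (T \<omega>)) (f \<omega>) \<partial>M)" for n
    proof -
      have "(\<integral>\<omega>. R n (T \<omega>) \<partial>M) = (\<integral>\<omega>. R n \<omega> \<partial>M)"
        using integral_distr[OF T, of "R n"] by (simp add: pres)
      moreover have "(\<integral>\<omega>. R n \<omega> \<partial>M) \<le> (\<integral>\<omega>. R (Suc n) \<omega> \<partial>M)"
        using R_int R_mono by (intro integral_mono) auto
      moreover have "(\<integral>\<omega>. R (Suc n) \<omega> - R n (T \<omega>) \<partial>M)
          = (\<integral>\<omega>. R (Suc n) \<omega> \<partial>M) - (\<integral>\<omega>. R n (T \<omega>) \<partial>M)"
        using R_int int_T by (intro Bochner_Integration.integral_diff) auto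
      ultimately show ?thesis unfolding eq by linarith
    qed
    have "(\<lambda>n. \<integral>\<omega>. max (- R n (T \<omega>)) (f \<omega>) \<partial>M) \<longlonglongrightarrow> (\<integral>\<omega>. f \<omega> \<partial>M)"
    proof (rule integral_dominated_convergence)
      show "integrable M (\<lambda>\<omega>. \<bar>f \<omega>\<bar>)" using int by simp
      \<comment> \<open>Since \<open>R n\<close> is nonnegative, the maximum lies between
        \<open>f\<close> and \<open>max 0 f\<close>.\<close>
      show "AE \<omega> in M. norm (max (- R n (T \<omega>)) (f \<omega>)) \<le> \<bar>f \<omega>\<bar>" for n
        by (intro AE_I2, use R_ge0[of n] in \<open>simp add: max_def\<close>)
          (smt (verit) R_ge0)
      show "AE \<omega> in M. (\<lambda>n. max (- R n (T \<omega>)) (f \<omega>)) \<longlonglongrightarrow> f \<omega>"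
      proof (use AEB in eventually_elim)
        fix \<omega> assume "\<omega> \<in> B"
        then have "T \<omega> \<in> B" using inv by auto
        moreover obtain K :: nat where K: "- f \<omega> \<le> real K" using real_arch_simple by blast
        ultimately obtain n where n: "S n (T \<omega>) > real K" by (auto simp: B_def)
        have "max (- R k (T \<omega>)) (f \<omega>) = f \<omega>" if "k \<ge> n" for k
        proof -
          have "S n (T \<omega>) \<le> R k (T \<omega>)" unfolding R_def using that by (intro Max_ge) auto
          with n K show ?thesis by simp
        qed
        then have "\<forall>\<^sub>F k in sequentially. max (- R k (T \<omega>)) (f \<omega>) = f \<omega>"
          by (auto simp: eventually_sequentially)
        then show "(\<lambda>n. max (- R n (T \<omega>)) (f \<omega>)) \<longlonglongrightarrow> f \<omega>" by (rule tendsto_eventually)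
      qed
    qed measurable
    with pos have "0 \<le> (\<integral>\<omega>. f \<omega> \<partial>M)" by (intro LIMSEQ_le_const) auto
    with neg show False by simp
  qed
  with B01 have "measure M B = 0" by simp
  then have "AE \<omega> in M. \<omega> \<notin> B" using prob_eq_0[OF B] by simp
  then show ?thesis
  proof (rule AE_mp, intro AE_I2 impI)
    fix \<omega> assume "\<omega> \<in> space M" "\<omega> \<notin> B"
    then obtain K :: nat where "\<forall>n. S n \<omega> \<le> real K" by (auto simp: B_def not_less)
    then show "\<exists>K. \<forall>n. (\<Sum>k<n. f ((T ^^ k) \<omega>)) \<le> K" unfolding S_def by blast
  qed
qed

text \<open>The functions \<open>f - I - e\<close> and \<open>I - f - e\<close> have integral
  \<open>- e\<close>, so their ergodic sums are bounded above; division by \<open>n\<close> puts the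
  averages within \<open>e\<close> of \<open>I\<close> in the limit. Countably many values
  \<open>e j\<close> suffice, which keeps the exceptional set null.\<close>

theorem birkhoff:
  fixes f :: "'w \<Rightarrow> real"
  assumes "prob_space M" and T: "T \<in> M \<rightarrow>\<^sub>M M" and pres: "distr M M T = M"
    and erg: "ergodic M T" and int: "integrable M f"
  shows "AE \<omega> in M. (\<lambda>n. (\<Sum>k<n. f ((T ^^ k) \<omega>)) / real n) \<longlonglongrightarrow> (\<integral>\<omega>. f \<omega> \<partial>M)"
proof -
  interpret prob_space M by fact
  define I where "I = (\<integral>\<omega>. f \<omega> \<partial>M)"
  define e where "e j = 1 / real (Suc j)" for j
  have e: "e j > 0" for j by (simp add: e_def)
  have "AE \<omega> in M. \<exists>K. \<forall>n. (\<Sum>k<n. f ((T ^^ k) \<omega>) - I - e j) \<le> K" for j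
    using int e[of j] prob_space by (intro birkhoff_bounded_above[OF assms(1-4)]) (auto simp: I_def)
  moreover have "AE \<omega> in M. \<exists>K. \<forall>n. (\<Sum>k<n. I - f ((T ^^ k) \<omega>) - e j) \<le> K" for j
    using int e[of j] prob_space by (intro birkhoff_bounded_above[OF assms(1-4)]) (auto simp: I_def)
  ultimately have "AE \<omega> in M. \<forall>j. (\<exists>K. \<forall>n. (\<Sum>k<n. f ((T ^^ k) \<omega>) - I - e j) \<le> K)
      \<and> (\<exists>K. \<forall>n. (\<Sum>k<n. I - f ((T ^^ k) \<omega>) - e j) \<le> K)"
    by (subst AE_all_countable) auto
  then show ?thesis
  proof (rule AE_mp, intro AE_I2 impI)
    fix \<omega> assume w: "\<forall>j. (\<exists>K. \<forall>n. (\<Sum>k<n. f ((T ^^ k) \<omega>) - I - e j) \<le> K)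
      \<and> (\<exists>K. \<forall>n. (\<Sum>k<n. I - f ((T ^^ k) \<omega>) - e j) \<le> K)"
    define S where "S n = (\<Sum>k<n. f ((T ^^ k) \<omega>))" for n
    have "(\<lambda>n. S n / real n) \<longlonglongrightarrow> I"
    proof (rule LIMSEQ_I)
      fix r :: real assume r: "r > 0"
      obtain j where j: "e j < r / 2" unfolding e_def using nat_approx_posE[of "r/2"] r by auto
      obtain K1 K2 where K: "\<And>n. S n - real n * I - real n * e j \<le> K1"
        "\<And>n. real n * I - S n - real n * e j \<le> K2"
        using spec[OF w, of j] by (force simp: sum_subtractf S_def)
      obtain N :: nat where N: "2 * (\<bar>K1\<bar> + \<bar>K2\<bar>) / r < real N" using reals_Archimedean2 by blast
      show "\<exists>N. \<forall>n\<ge>N. norm (S n / real n - I) < r"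
      proof (intro exI allI impI)
        fix n assume n: "n \<ge> Suc N"
        then have n0: "real n > 0" by simp
        have "2 * (\<bar>K1\<bar> + \<bar>K2\<bar>) / r < real n" using N n by linarith
        then have a: "\<bar>K1\<bar> + \<bar>K2\<bar> < real n * (r / 2)" using r by (simp add: field_simps)
        have b: "real n * e j < real n * (r / 2)" using j n0 by (intro mult_strict_left_mono)
        have "\<bar>S n - real n * I\<bar> < real n * r"
          using K[of n] a b by (simp add: algebra_simps)
        then show "norm (S n / real n - I) < r" using n0 by (simp add: field_simps abs_if split: if_splits)
      qed
    qed
    then show "(\<lambda>n. (\<Sum>k<n. f ((T ^^ k) \<omega>)) / real n) \<longlonglongrightarrow> (\<integral>\<omega>. f \<omega> \<partial>M)"
      by (simp add: S_def I_def)
  qed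
qed

text \<open>The quantiles of \<open>G\<close> at the levels \<open>i / m\<close> cut the line into
  finitely many pieces. Convergence at these finitely many points is simultaneous, and monotonicity
  carries it to the points in between.\<close>

lemma polya_uniform_limit:
  fixes F :: "nat \<Rightarrow> real \<Rightarrow> real" and G :: "real \<Rightarrow> real"
  assumes mono_F: "\<And>n. mono (F n)" and F0: "\<And>n x. 0 \<le> F n x" and F1: "\<And>n x. F n x \<le> 1"
    and cont: "continuous_on UNIV G" and mono_G: "mono G"
    and bot: "(G \<longlongrightarrow> 0) at_bot" and top: "(G \<longlongrightarrow> 1) at_top"
    and lim: "\<And>x. (\<lambda>n. F n x) \<longlonglongrightarrow> G x"
  shows "uniform_limit UNIV F G sequentially"
proof (rule uniform_limitI)
  fix e :: real assume e: "e > 0"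
  obtain m :: nat where m: "4 / e < real m" using reals_Archimedean2 by blast
  have m0: "real m > 0" using m e by (smt (verit) divide_pos_pos)
  have m4: "4 / real m < e" using m m0 e by (simp add: field_simps)
  have G_bounds: "0 \<le> G x" "G x \<le> 1" for x
  proof -
    show "0 \<le> G x" using F0 lim[of x] by (intro LIMSEQ_le_const) auto
    show "G x \<le> 1" using F1 lim[of x] by (intro LIMSEQ_le_const2) auto
  qed
  have ex: "\<exists>x. G x = y" if y: "0 < y" "y < 1" for y
  proof -
    have "\<forall>\<^sub>F x in at_bot. G x < y" "\<forall>\<^sub>F x in at_top. G x > y"
      using order_tendstoD(2)[OF bot y(1)] order_tendstoD(1)[OF top y(2)] by auto
    then obtain l u where "\<forall>x\<le>l. G x < y" "\<forall>x\<ge>u. G x > y"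
      by (auto simp: eventually_at_bot_linorder eventually_at_top_linorder)
    moreover define l' u' where "l' = min l u" and "u' = max l u"
    ultimately have "G l' \<le> y" "y \<le> G u'" "l' \<le> u'" by (auto intro: less_imp_le)
    then show ?thesis
      using IVT'[of G l' y u'] continuous_on_subset[OF cont, of "{l'..u'}"] by auto
  qed
  then have "\<exists>X. \<forall>i::nat. 0 < i \<longrightarrow> i < m \<longrightarrow> G (X i) = real i / real m"
    by (intro choice allI) (smt (verit) divide_less_eq_1_pos divide_pos_pos m0 of_nat_0_less_iff of_nat_less_iff)
  then obtain X where X: "\<And>i. 0 < i \<Longrightarrow> i < m \<Longrightarrow> G (X i) = real i / real m" by blast
  have "\<forall>\<^sub>F n in sequentially. \<forall>i\<in>{..<m}. dist (F n (X i)) (G (X i)) < 1 / real m"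
    using lim m0 by (intro eventually_ball_finite) (auto intro: tendstoD)
  then show "\<forall>\<^sub>F n in sequentially. \<forall>x\<in>UNIV. dist (F n x) (G x) < e"
  proof (eventually_elim, intro ballI)
    fix n x
    assume H: "\<forall>i\<in>{..<m}. dist (F n (X i)) (G (X i)) < 1 / real m"
    define j where "j = nat \<lfloor>G x * real m\<rfloor>"
    have "0 \<le> G x * real m" using G_bounds m0 by simp
    then have j: "real j \<le> G x * real m" "G x * real m < real j + 1"
      unfolding j_def by linarith+
    have up: "F n x \<le> G x + 2 / real m"
    proof (cases "j + 1 < m")
      case True
      then have "G (X (j+1)) = real (j+1) / real m" using X by auto
      with j m0 have "G x < G (X (j+1))" by (simp add: pos_less_divide_eq add.commute)
      then have "x \<le> X (j+1)" using mono_G by (meson leD le_cases monoD)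
      then have "F n x \<le> F n (X (j+1))" using mono_F by (simp add: monoD)
      moreover have "F n (X (j+1)) < G (X (j+1)) + 1 / real m"
        using bspec[OF H, of "j+1"] True by (auto simp: dist_real_def)
      moreover have "G (X (j+1)) \<le> G x + 1 / real m"
        using j m0 X[of "j+1"] True by (simp add: field_simps)
      ultimately show ?thesis using m0 by simp
    next
      case False
      then have "real m \<le> real j + 1" by linarith
      with j have "real m \<le> G x * real m + 2" by linarith
      then have "1 \<le> G x + 2 / real m" using m0 by (simp add: field_simps)
      then show ?thesis using F1[of n x] by linarith
    qed
    \<comment> \<open>The comparison point is \<open>X (j-1)\<close> and not \<open>X j\<close>:
      only the strict inequality \<open>G (X (j-1)) < G x\<close> determines the order of the two
      points. This costs one more level, for a total of \<open>3 / m\<close>, which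
      \<open>m > 4 / e\<close> allows.\<close>
    have low: "F n x \<ge> G x - 3 / real m"
    proof (cases "j \<ge> 2")
      case True
      have "G x * real m \<le> real m" using G_bounds m0 by simp
      with j have "j \<le> m" by linarith
      with True have jm: "0 < j - 1" "j - 1 < m" by auto
      have Xj: "G (X (j-1)) = (real j - 1) / real m" using X[OF jm] True by (simp add: of_nat_diff)
      with j m0 have "G (X (j-1)) < G x" by (simp add: pos_divide_less_eq)
      then have "X (j-1) \<le> x" using mono_G by (meson leD le_cases monoD)
      then have "F n (X (j-1)) \<le> F n x" using mono_F by (simp add: monoD)
      moreover have "F n (X (j-1)) > G (X (j-1)) - 1 / real m"
        using bspec[OF H, of "j-1"] jm by (auto simp: dist_real_def)
      moreover have "G (X (j-1)) \<ge> G x - 2 / real m"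
        using j m0 Xj by (simp add: field_simps)
      ultimately show ?thesis using m0 by simp
    next
      case False
      then have "real j \<le> 1" by linarith
      with j have "G x * real m \<le> 3" by linarith
      then have "G x \<le> 3 / real m" using m0 by (simp add: field_simps)
      then show ?thesis using F0[of n x] by linarith
    qed
    have "2 / real m < e" "3 / real m < e"
      using m0 by (auto intro!: le_less_trans[OF _ m4] divide_right_mono)
    with up low show "dist (F n x) (G x) < e"
      by (simp add: dist_real_def abs_less_iff)
  qed
qed

section \<open>Finite paths of the walk\<close>

text \<open>With the most recent site in front, a step is a \<open>Cons\<close> and the current site
  is \<open>hd\<close>.\<close>

primrec history :: "nat \<Rightarrow> (nat \<Rightarrow> 'a) \<Rightarrow> 'a list" where
  "history 0 x = [x 0]"
| "history (Suc t) x = x (Suc t) # history t x"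

text \<open>The law of a finite piece of path has finite support, so every function of it is
  integrable and one-step conditioning is a finite computation.\<close>

primrec path_pmf :: "(int \<Rightarrow> real) \<Rightarrow> int \<Rightarrow> nat \<Rightarrow> int list pmf" where
  "path_pmf a z 0 = return_pmf [z]"
| "path_pmf a z (Suc t) =
     bind_pmf (path_pmf a z t) (\<lambda>l. map_pmf (\<lambda>v. v # l) (walk_step a (hd l)))"

lemma history_eq_iff: "history t x = history t y \<longleftrightarrow> (\<forall>i\<le>t. x i = y i)"
  by (induction t) (auto simp: le_Suc_eq)

lemma hd_history [simp]: "hd (history t x) = x t"
  by (cases t) auto

lemma set_history: "set (history t x) = x ` {..t}"
  by (induction t) (auto simp: atMost_Suc)

lemma length_history [simp]: "length (history t x) = Suc t"
  by (induction t) auto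

lemma history_surj: "length l = Suc t \<Longrightarrow> \<exists>y. l = history t y"
proof (induction t arbitrary: l)
  case 0
  then obtain v where "l = [v]" by (auto simp: length_Suc_conv)
  then show ?case by (auto intro!: exI[of _ "\<lambda>_. v"])
next
  case (Suc t)
  then obtain v l' where l: "l = v # l'" "length l' = Suc t" by (auto simp: length_Suc_conv)
  with Suc.IH obtain y where y: "l' = history t y" by blast
  have "history t (y(Suc t := v)) = history t y" by (subst history_eq_iff) auto
  with l y show ?case by (intro exI[of _ "y(Suc t := v)"]) (simp del: fun_upd_apply, simp)
qed

lemma finite_set_walk_step: "finite (set_pmf (walk_step a n))"
  by (simp add: walk_step_def)

lemma set_walk_step: "set_pmf (walk_step a n) \<subseteq> {n - 1, n + 1}"
  by (auto simp: walk_step_def)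

lemma finite_set_path_pmf: "finite (set_pmf (path_pmf a z t))"
  by (induction t) (auto simp: finite_set_walk_step)

lemma length_path_pmf: "l \<in> set_pmf (path_pmf a z t) \<Longrightarrow> length l = Suc t"
  by (induction t arbitrary: l) auto

lemma hd_path_pmf: "l \<in> set_pmf (path_pmf a z t) \<Longrightarrow> \<bar>hd l - z\<bar> \<le> int t"
proof (induction t arbitrary: l)
  case (Suc t)
  then obtain l' v where l: "l' \<in> set_pmf (path_pmf a z t)" "v \<in> set_pmf (walk_step a (hd l'))"
    "l = v # l'" by auto
  with Suc.IH[OF l(1)] set_walk_step[of a "hd l'"] show ?case by auto
qed auto

lemma expectation_walk_step:
  fixes f :: "int \<Rightarrow> 'b :: {banach, second_countable_topology}"
  assumes "0 \<le> a n" "a n \<le> 1"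
  shows "measure_pmf.expectation (walk_step a n) f = a n *\<^sub>R f (n + 1) + (1 - a n) *\<^sub>R f (n - 1)"
  using assms unfolding walk_step_def integral_map_pmf
  by (subst integral_measure_pmf[of UNIV]) (auto simp: UNIV_bool)

lemma expectation_path_pmf_Suc:
  fixes f :: "int list \<Rightarrow> 'b :: {banach, second_countable_topology}"
  assumes "\<And>n. 0 \<le> a n" "\<And>n. a n \<le> 1"
  shows "measure_pmf.expectation (path_pmf a z (Suc t)) f =
    measure_pmf.expectation (path_pmf a z t)
      (\<lambda>l. a (hd l) *\<^sub>R f ((hd l + 1) # l) + (1 - a (hd l)) *\<^sub>R f ((hd l - 1) # l))"
  unfolding path_pmf.simps
  by (subst pmf_expectation_bind[OF finite_set_path_pmf[of a z t]])
    (auto simp: finite_set_walk_step expectation_walk_step assms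
      integral_measure_pmf[OF finite_set_path_pmf[of a z t]])

lemma pmf_path_pmf_history:
  "pmf (path_pmf a z t) (history t y) =
     indicator {z} (y 0) * (\<Prod>i<t. pmf (walk_step a (y i)) (y (Suc i)))"
proof (induction t)
  case 0
  show ?case by (simp add: indicator_def)
next
  case (Suc t)
  have eq: "pmf (map_pmf (\<lambda>v. v # l) (walk_step a (hd l))) (history (Suc t) y)
      = indicator {history t y} l * pmf (walk_step a (y t)) (y (Suc t))" for l
  proof (cases "l = history t y")
    case True
    have "pmf (map_pmf ((\<lambda>l v. v # l) l) p) (v # l) = pmf p v" for p and v :: int
      by (rule pmf_map_inj') (simp add: inj_def)
    with True show ?thesis by simp
  next
    case False
    then have "history (Suc t) y \<notin> set_pmf (map_pmf (\<lambda>v. v # l) (walk_step a (hd l)))" by auto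
    then show ?thesis using False by (simp add: pmf_eq_0_set_pmf)
  qed
  have "pmf (path_pmf a z (Suc t)) (history (Suc t) y) =
      pmf (path_pmf a z t) (history t y) * pmf (walk_step a (y t)) (y (Suc t))"
    unfolding path_pmf.simps pmf_bind eq by (simp add: measure_pmf_single)
  with Suc.IH show ?case by simp
qed

section \<open>Transfer between path space and finite paths\<close>

lemma sets_history_eq: "{x. history t x = history t y} \<in> sets (walk_law a z)"
proof -
  have "Measurable.pred (walk_law a z) (\<lambda>x. \<forall>i\<in>{..t}. x i = y i)"
    by measurable
  then show ?thesis by (simp add: pred_def history_eq_iff Ball_def space_PiM)
qed

lemma measurable_history [measurable]: "history t \<in> walk_law a z \<rightarrow>\<^sub>M count_space UNIV"
proof (rule measurable_count_space_eq2_countable[THEN iffD2], intro conjI ballI)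
  fix l :: "int list"
  show "history t -` {l} \<inter> space (walk_law a z) \<in> sets (walk_law a z)"
  proof (cases "length l = Suc t")
    case True
    then obtain y where "l = history t y" using history_surj by blast
    then have "history t -` {l} \<inter> space (walk_law a z) = {x. history t x = history t y}"
      by (auto simp: space_PiM)
    then show ?thesis using sets_history_eq by simp
  next
    case False
    then have "history t -` {l} \<inter> space (walk_law a z) = {}" by auto
    then show ?thesis by simp
  qed
qed auto

text \<open>Both measures live on countably many lists: a list of length \<open>Suc t\<close>
  receives its cylinder probability on either side, any other list receives 0.\<close>

lemma distr_history: "distr (walk_law a z) (count_space UNIV) (history t) = measure_pmf (path_pmf a z t)"
proof (rule measure_eqI_countable[of _ UNIV])
  fix l :: "int list"
  have *: "emeasure (distr (walk_law a z) (count_space UNIV) (history t)) {l}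
      = emeasure (walk_law a z) {x. history t x = l}"
    by (subst emeasure_distr) (auto simp: space_PiM intro!: arg_cong2[where f=emeasure])
  show "emeasure (distr (walk_law a z) (count_space UNIV) (history t)) {l}
      = emeasure (measure_pmf (path_pmf a z t)) {l}"
  proof (cases "length l = Suc t")
    case True
    then obtain y where y: "l = history t y" using history_surj by blast
    show ?thesis unfolding *[unfolded y] y
      by (simp add: history_eq_iff walk_law_cylinder emeasure_pmf_single pmf_path_pmf_history)
  next
    case False
    then have "{x. history t x = l} = {}" by auto
    moreover have "l \<notin> set_pmf (path_pmf a z t)" using False length_path_pmf by blast
    ultimately show ?thesis unfolding *
      by (simp add: emeasure_pmf_single pmf_eq_0_set_pmf)
  qed
qed auto

lemma prob_space_walk_law: "prob_space (walk_law a z)"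
proof (rule prob_spaceI)
  have "emeasure (walk_law a z) (space (walk_law a z)) =
      emeasure (distr (walk_law a z) (count_space UNIV) (history 0)) UNIV"
    by (subst emeasure_distr) auto
  then show "emeasure (walk_law a z) (space (walk_law a z)) = 1"
    using measure_pmf.emeasure_space_1[of "path_pmf a z 0"] by (simp add: distr_history)
qed

lemma integral_history:
  fixes f :: "int list \<Rightarrow> 'b :: {banach, second_countable_topology}"
  shows "(\<integral>x. f (history t x) \<partial>walk_law a z) = measure_pmf.expectation (path_pmf a z t) f"
  by (subst distr_history[symmetric], subst integral_distr) auto

lemma integrable_history:
  fixes f :: "int list \<Rightarrow> 'b :: {banach, second_countable_topology}"
  shows "integrable (walk_law a z) (\<lambda>x. f (history t x))"
  using integrable_distr_eq[of "history t" "walk_law a z" "count_space UNIV" f]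
    integrable_measure_pmf_finite[OF finite_set_path_pmf[of a z t], of f]
  by (simp add: distr_history)

lemma measure_history:
  "measure (walk_law a z) {x. P (history t x)} = measure (path_pmf a z t) {l. P l}"
proof -
  have "measure (path_pmf a z t) {l. P l} = measure (walk_law a z) (history t -` {l. P l} \<inter> space (walk_law a z))"
    by (subst distr_history[symmetric], subst measure_distr) auto
  then show ?thesis by (simp add: vimage_def space_PiM)
qed

section \<open>The martingale \<open>H(X(t)) - t\<close>\<close>

text \<open>The primitive of \<open>d\<close> on all integers that vanishes at 0; the sign for
  negative \<open>n\<close> makes its increment from \<open>n\<close> to \<open>n + 1\<close> equal
  to \<open>d n\<close> everywhere. The walk may visit negative sites, where \<open>env_H\<close> is
  not defined.\<close>

definition isum :: "(int \<Rightarrow> real) \<Rightarrow> int \<Rightarrow> real" where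
  "isum d n = (if 0 \<le> n then \<Sum>k\<in>{0..<n}. d k else - (\<Sum>k\<in>{n..<0}. d k))"

lemma isum_0 [simp]: "isum d 0 = 0"
  by (simp add: isum_def)

lemma isum_Suc: "isum d (n + 1) = isum d n + d n"
proof (cases "0 \<le> n")
  case True
  then have "{0..<n + 1} = insert n {0..<n}" by auto
  with True show ?thesis by (simp add: isum_def)
next
  case False
  then have "{n..<0} = insert n {n + 1..<0}" by auto
  with False show ?thesis by (auto simp: isum_def)
qed

lemma isum_pred: "isum d (n - 1) = isum d n - d (n - 1)"
  using isum_Suc[of d "n - 1"] by simp

lemma isum_diff: "m \<le> n \<Longrightarrow> isum d n - isum d m = (\<Sum>k\<in>{m..<n}. d k)"
proof (induction n rule: int_ge_induct)
  case (step n)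
  then have "{m..<n + 1} = insert n {m..<n}" by auto
  with step show ?case by (simp add: isum_Suc)
qed simp

lemma isum_diff_le:
  assumes "\<And>k. \<bar>d k\<bar> \<le> C"
  shows "\<bar>isum d n - isum d m\<bar> \<le> C * \<bar>real_of_int (n - m)\<bar>"
proof -
  have *: "\<bar>isum d n - isum d m\<bar> \<le> C * \<bar>real_of_int (n - m)\<bar>" if "m \<le> n" for m n
  proof -
    have "\<bar>\<Sum>k\<in>{m..<n}. d k\<bar> \<le> (\<Sum>k\<in>{m..<n}. C)"
      using assms by (intro order_trans[OF sum_abs] sum_mono)
    with that show ?thesis by (simp add: isum_diff mult.commute)
  qed
  show ?thesis
    using *[of m n] *[of n m] by (cases "m \<le> n") (auto simp: abs_minus_commute)
qed

lemma isum_diff_ge: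
  assumes "\<And>k. 1 \<le> d k" "m \<le> n"
  shows "real_of_int (n - m) \<le> isum d n - isum d m"
proof -
  have "(\<Sum>k\<in>{m..<n}. 1) \<le> (\<Sum>k\<in>{m..<n}. d k)" using assms by (intro sum_mono)
  with assms(2) show ?thesis by (simp add: isum_diff)
qed

lemma isum_abs_diff_ge:
  assumes "\<And>k. 1 \<le> d k"
  shows "\<bar>real_of_int (n - m)\<bar> \<le> \<bar>isum d n - isum d m\<bar>"
  using isum_diff_ge[of d, OF assms, of m n] isum_diff_ge[of d, OF assms, of n m] by (cases "m \<le> n") auto

section \<open>Elementary limits and exponential estimates\<close>

lemma tendsto_zero_sqrtI:
  fixes f :: "nat \<Rightarrow> real"
  assumes "\<And>t. 0 \<le> f t" "0 \<le> c"
    and K: "\<And>\<delta>. \<delta> > 0 \<Longrightarrow> \<exists>K. \<forall>t\<ge>1. f t \<le> \<delta> * c + K / sqrt (real t)"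
  shows "f \<longlonglongrightarrow> 0"
proof (rule LIMSEQ_I)
  fix r :: real assume r: "r > 0"
  \<comment> \<open>Half of \<open>r\<close> pays for the slack \<open>\<delta> * c\<close>; the
    other half pays for \<open>K / sqrt t\<close>, where \<open>K\<close> may depend on \<delta>.
    The denominator \<open>c + 1\<close> covers \<open>c = 0\<close>.\<close>
  define \<delta> where "\<delta> = r / (2 * (c + 1))"
  have \<delta>: "\<delta> > 0" "\<delta> * c \<le> r / 2" using r assms(2) by (auto simp: \<delta>_def field_simps)
  obtain K where K: "\<And>t. t \<ge> 1 \<Longrightarrow> f t \<le> \<delta> * c + K / sqrt (real t)" using K[OF \<delta>(1)] by blast
  have "(\<lambda>t. K / sqrt (real t)) \<longlonglongrightarrow> 0"
    by (rule real_tendsto_divide_at_top[OF tendsto_const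
          filterlim_compose[OF sqrt_at_top filterlim_real_sequentially]])
  then have "\<forall>\<^sub>F t in sequentially. K / sqrt (real t) < r / 2"
    using r by (intro order_tendstoD) auto
  then have "\<forall>\<^sub>F t in sequentially. norm (f t - 0) < r"
    using eventually_ge_at_top[of 1]
  proof eventually_elim
    case (elim t)
    then have "f t < r" using K[of t] \<delta> by linarith
    then show ?case using assms(1)[of t] by simp
  qed
  then show "\<exists>N. \<forall>n\<ge>N. norm (f n - 0) < r" by (simp add: eventually_sequentially)
qed

text \<open>Turns an asymptotic statement into an inequality without threshold: \<open>K\<close>
  absorbs the finitely many indices up to \<open>N\<close>.\<close>

lemma sublinear_bound:
  fixes f :: "nat \<Rightarrow> real"
  assumes lim: "(\<lambda>n. f n / real n) \<longlonglongrightarrow> 0" and \<delta>: "\<delta> > 0"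
  shows "\<exists>K\<ge>0. \<forall>n. \<bar>f n\<bar> \<le> \<delta> * real n + K"
proof -
  obtain N where N: "\<And>n. n \<ge> N \<Longrightarrow> \<bar>f n / real n\<bar> < \<delta>"
    using LIMSEQ_D[OF lim \<delta>] by auto
  define K where "K = (\<Sum>n\<le>N. \<bar>f n\<bar>)"
  have "\<bar>f n\<bar> \<le> \<delta> * real n + K" for n
  proof (cases "n \<le> N")
    case True
    then have "\<bar>f n\<bar> \<le> K" unfolding K_def by (intro member_le_sum) auto
    moreover have "0 \<le> \<delta> * real n" using \<delta> by simp
    ultimately show ?thesis by linarith
  next
    case False
    then have "real n > 0" by simp
    then have "\<bar>f n\<bar> < \<delta> * real n" using N[of n] False by (simp add: field_simps)
    moreover have "0 \<le> K" by (simp add: K_def sum_nonneg)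
    ultimately show ?thesis by linarith
  qed
  moreover have "0 \<le> K" by (simp add: K_def sum_nonneg)
  ultimately show ?thesis by blast
qed

lemma exp_diff_le:
  fixes x y K :: real
  assumes "x \<le> K" "y \<le> K"
  shows "\<bar>exp x - exp y\<bar> \<le> exp K * \<bar>x - y\<bar>"
proof -
  have *: "exp x - exp y \<le> exp K * (x - y)" if "y \<le> x" "x \<le> K" for x y :: real
  proof -
    have "1 - exp (y - x) \<le> x - y" using exp_ge_add_one_self[of "y - x"] by linarith
    then have "exp x * (1 - exp (y - x)) \<le> exp x * (x - y)" by (intro mult_left_mono) auto
    also have "\<dots> \<le> exp K * (x - y)" using that by (intro mult_right_mono) auto
    finally show ?thesis by (simp add: algebra_simps flip: exp_add)
  qed
  show ?thesis
    using *[of y x] *[of x y] assms by (cases "y \<le> x") (auto simp: abs_if)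
qed

text \<open>For the exponent \<open>z\<close>, the second Taylor polynomial
  \<open>1 + z + z^2 / 2\<close> differs from the stated one only by \<open>y\<close>, which
  collects the terms of \<open>z^2 / 2\<close> of order \<open>u^3\<close> and \<open>u^4\<close>.
  The Taylor remainder contributes the factor 4 and \<open>y\<close> the factor 1, hence the
  5.\<close>

lemma exp_quadratic_remainder:
  fixes D e u B :: real
  assumes D: "\<bar>D\<bar> \<le> B" and e: "\<bar>e\<bar> \<le> B" and u: "\<bar>u\<bar> \<le> 1" and B: "1 \<le> B"
  shows "cmod (exp (Complex (u\<^sup>2 / 2 * e) (u * D)) - Complex (1 + u\<^sup>2 / 2 * (e - D\<^sup>2)) (u * D))
    \<le> 5 * B ^ 3 * exp B * \<bar>u\<bar> ^ 3"
proof -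
  define z where "z = Complex (u\<^sup>2 / 2 * e) (u * D)"
  have "\<bar>u\<bar> * \<bar>u\<bar> \<le> 1 * \<bar>u\<bar>" using u by (intro mult_right_mono) auto
  then have u2: "u\<^sup>2 \<le> \<bar>u\<bar>" by (simp add: power2_eq_square)
  have "\<bar>u\<^sup>2 / 2 * e\<bar> \<le> \<bar>u\<bar> / 2 * B" unfolding abs_mult using u2 e B by (intro mult_mono) auto
  moreover have "\<bar>u * D\<bar> \<le> \<bar>u\<bar> * B" unfolding abs_mult using D by (intro mult_left_mono) auto
  moreover have "0 \<le> \<bar>u\<bar> * B" using B by simp
  moreover have "Re z = u\<^sup>2 / 2 * e" "Im z = u * D" by (simp_all add: z_def)
  ultimately have z': "cmod z \<le> 2 * (\<bar>u\<bar> * B)" and z2: "\<bar>Re z\<bar> \<le> \<bar>u\<bar> / 2 * B"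
    using cmod_le[of z] by auto
  from z' have z1: "cmod z \<le> 2 * B * \<bar>u\<bar>" by (simp add: mult_ac)
  note z = z1 z2
  have "\<bar>u\<bar> / 2 * B \<le> 1 * B" using u B by (intro mult_right_mono) auto
  with z(2) have Re: "\<bar>Re z\<bar> \<le> B" by linarith
  have "cmod (exp z - (\<Sum>k\<le>2. z ^ k / fact k)) \<le> exp \<bar>Re z\<bar> * cmod z ^ Suc 2 / fact 2"
    by (rule Taylor_exp)
  also have "\<dots> \<le> exp B * (2 * B * \<bar>u\<bar>) ^ Suc 2 / fact 2"
    using z Re by (intro divide_right_mono mult_mono power_mono) auto
  also have "\<dots> = 4 * B ^ 3 * exp B * \<bar>u\<bar> ^ 3" by (simp add: power_mult_distrib eval_nat_numeral)
  finally have 1: "cmod (exp z - (1 + z + z\<^sup>2 / 2)) \<le> 4 * B ^ 3 * exp B * \<bar>u\<bar> ^ 3"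
    by (simp add: eval_nat_numeral)
  define y where "y = Complex (u ^ 4 * e\<^sup>2 / 8) (u ^ 3 * (D * e) / 2)"
  have y: "1 + z + z\<^sup>2 / 2 - Complex (1 + u\<^sup>2 / 2 * (e - D\<^sup>2)) (u * D) = y"
    by (simp add: z_def y_def complex_eq_iff power2_eq_square eval_nat_numeral field_simps)
  have "\<bar>u ^ 4 * e\<^sup>2 / 8\<bar> \<le> \<bar>u\<bar> ^ 3 * B\<^sup>2 / 8"
  proof -
    have "e\<^sup>2 \<le> B\<^sup>2" using e by (simp add: abs_le_square_iff[symmetric])
    moreover have "\<bar>u\<bar> ^ 4 \<le> \<bar>u\<bar> ^ 3" using u by (intro power_decreasing) auto
    ultimately have "\<bar>u\<bar> ^ 4 * e\<^sup>2 \<le> \<bar>u\<bar> ^ 3 * B\<^sup>2" by (intro mult_mono) auto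
    then show ?thesis by (simp add: abs_mult power_abs)
  qed
  moreover have "\<bar>u ^ 3 * (D * e) / 2\<bar> \<le> \<bar>u\<bar> ^ 3 * B\<^sup>2 / 2"
  proof -
    have "\<bar>D\<bar> * \<bar>e\<bar> \<le> B * B" using D e B by (intro mult_mono) auto
    then have "\<bar>u\<bar> ^ 3 * (\<bar>D\<bar> * \<bar>e\<bar>) \<le> \<bar>u\<bar> ^ 3 * B\<^sup>2"
      by (intro mult_left_mono) (auto simp: power2_eq_square)
    then show ?thesis by (simp add: abs_mult power_abs)
  qed
  moreover have "Re y = u ^ 4 * e\<^sup>2 / 8" "Im y = u ^ 3 * (D * e) / 2" by (simp_all add: y_def)
  ultimately have "cmod y \<le> \<bar>u\<bar> ^ 3 * B\<^sup>2 / 8 + \<bar>u\<bar> ^ 3 * B\<^sup>2 / 2"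
    using cmod_le[of y] by linarith
  also have "\<dots> \<le> \<bar>u\<bar> ^ 3 * B\<^sup>2" by simp
  also have "\<dots> \<le> \<bar>u\<bar> ^ 3 * (B ^ 3 * exp B)"
  proof (intro mult_left_mono)
    have "B\<^sup>2 * 1 \<le> B ^ 3 * exp B" using B by (intro mult_mono power_increasing) auto
    then show "B\<^sup>2 \<le> B ^ 3 * exp B" by simp
  qed auto
  finally have 2: "cmod y \<le> B ^ 3 * exp B * \<bar>u\<bar> ^ 3" by (simp add: mult.commute)
  have "cmod (exp z - Complex (1 + u\<^sup>2 / 2 * (e - D\<^sup>2)) (u * D))
      \<le> cmod (exp z - (1 + z + z\<^sup>2 / 2)) + cmod y"
    unfolding y[symmetric] by (rule order_trans[OF _ norm_triangle_ineq]) simp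
  with 1 2 show ?thesis by (simp add: z_def)
qed

text \<open>The quenched input for one fixed environment. \<open>mu_eq\<close> says that
  \<open>H\<close> gains 1 per step on average; the right side of \<open>g_eq\<close> is the
  variance of that gain and its left side is the mean gain of \<open>G\<close>. Thus
  \<open>G\<close> compensates the square of the martingale.\<close>

locale drift_walk =
  fixes a \<mu> g :: "int \<Rightarrow> real" and C :: real
  assumes a_pos: "0 < a n" and a_less_1: "a n < 1"
    and mu_ge_1: "1 \<le> \<mu> n" and mu_le: "\<mu> n \<le> C"
    and mu_eq: "a n * \<mu> n - (1 - a n) * \<mu> (n - 1) = 1"
    and g_nonneg: "0 \<le> g n" and g_le: "g n \<le> C"
    and g_eq: "a n * g n - (1 - a n) * g (n - 1) = a n * (\<mu> n)\<^sup>2 + (1 - a n) * (\<mu> (n - 1))\<^sup>2 - 1"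
begin

abbreviation E :: "int \<Rightarrow> nat \<Rightarrow> (int list \<Rightarrow> 'b::{banach, second_countable_topology}) \<Rightarrow> 'b" where
  "E z t f \<equiv> measure_pmf.expectation (path_pmf a z t) f"

abbreviation "H \<equiv> isum \<mu>"
abbreviation "G \<equiv> isum g"

lemma C_ge_1: "1 \<le> C" using mu_ge_1[of 0] mu_le[of 0] by linarith

lemma integrable_path [simp]:
  "integrable (measure_pmf (path_pmf a z t)) (f :: _ \<Rightarrow> 'b::{banach, second_countable_topology})"
  by (rule integrable_measure_pmf_finite[OF finite_set_path_pmf])

lemma E_mono:
  fixes f h :: "int list \<Rightarrow> real"
  shows "(\<And>l. l \<in> set_pmf (path_pmf a z t) \<Longrightarrow> f l \<le> h l) \<Longrightarrow> E z t f \<le> E z t h"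
  by (intro integral_mono_AE) (auto simp: AE_measure_pmf_iff)

lemma E_Suc:
  fixes f :: "int list \<Rightarrow> 'b::{banach, second_countable_topology}"
  shows "E z (Suc t) f = E z t (\<lambda>l. a (hd l) *\<^sub>R f ((hd l + 1) # l) + (1 - a (hd l)) *\<^sub>R f ((hd l - 1) # l))"
  using a_pos a_less_1 by (intro expectation_path_pmf_Suc) (auto intro: less_imp_le)

text \<open>The terms linear in \<open>h\<close> cancel by \<open>mu_eq\<close>, and what remains is
  the step variance. As \<open>h\<close> is arbitrary, the identity serves both the second moment of
  the walk and the variance of the hitting time.\<close>

lemma second_moment_step:
  "a n * (h + \<mu> n - 1)\<^sup>2 + (1 - a n) * (h - \<mu> (n - 1) - 1)\<^sup>2
     = h\<^sup>2 + (a n * g n - (1 - a n) * g (n - 1))"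
  unfolding g_eq using mu_eq[of n] by algebra

lemma second_moment_le: "E 0 t (\<lambda>l. (H (hd l) - real t)\<^sup>2) \<le> C\<^sup>2 * real t"
proof (induction t)
  case (Suc t)
  have "E 0 (Suc t) (\<lambda>l. (H (hd l) - real (Suc t))\<^sup>2) \<le> E 0 t (\<lambda>l. (H (hd l) - real t)\<^sup>2 + C\<^sup>2)"
    unfolding E_Suc
  proof (rule E_mono)
    fix l :: "int list"
    define n where "n = hd l"
    have "a n * (\<mu> n)\<^sup>2 + (1 - a n) * (\<mu> (n - 1))\<^sup>2 \<le> a n * C\<^sup>2 + (1 - a n) * C\<^sup>2"
      using a_pos[of n] a_less_1[of n] mu_ge_1[of n] mu_le[of n] mu_ge_1[of "n-1"] mu_le[of "n-1"]
      by (intro add_mono mult_left_mono power_mono) auto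
    then have "a n * g n - (1 - a n) * g (n - 1) \<le> C\<^sup>2" unfolding g_eq by (simp add: algebra_simps)
    then show "a (hd l) *\<^sub>R (H (hd ((hd l + 1) # l)) - real (Suc t))\<^sup>2
        + (1 - a (hd l)) *\<^sub>R (H (hd ((hd l - 1) # l)) - real (Suc t))\<^sup>2 \<le> (H (hd l) - real t)\<^sup>2 + C\<^sup>2"
      using second_moment_step[of n "H n - real t"]
      by (simp add: n_def[symmetric] isum_Suc isum_pred) (simp add: algebra_simps)
  qed
  also have "\<dots> = E 0 t (\<lambda>l. (H (hd l) - real t)\<^sup>2) + C\<^sup>2"
    by (subst Bochner_Integration.integral_add) auto
  finally show ?case using Suc by (simp add: algebra_simps)
qed simp

text \<open>The elementary bound \<open>\<bar>x\<bar> \<le> x^2 / (2 * b) + b / 2\<close> takes the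
  place of Cauchy-Schwarz; with \<open>b = C * sqrt t\<close> both terms are at most
  \<open>b / 2\<close> in mean.\<close>

lemma first_moment_le:
  "E 0 t (\<lambda>l. \<bar>H (hd l) - real t\<bar>) \<le> C * sqrt (real t)"
proof (cases "t = 0")
  case False
  define b where "b = C * sqrt (real t)"
  have b: "b > 0" using C_ge_1 False by (simp add: b_def)
  have "E 0 t (\<lambda>l. \<bar>H (hd l) - real t\<bar>) \<le> E 0 t (\<lambda>l. (H (hd l) - real t)\<^sup>2 / (2 * b) + b / 2)"
  proof (rule E_mono)
    fix l :: "int list"
    have "0 \<le> (\<bar>H (hd l) - real t\<bar> - b)\<^sup>2" by simp
    then have "2 * b * \<bar>H (hd l) - real t\<bar> \<le> (H (hd l) - real t)\<^sup>2 + b\<^sup>2"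
      by (simp add: power2_diff algebra_simps)
    then show "\<bar>H (hd l) - real t\<bar> \<le> (H (hd l) - real t)\<^sup>2 / (2 * b) + b / 2"
      using b by (simp add: field_simps power2_eq_square)
  qed
  also have "\<dots> = E 0 t (\<lambda>l. (H (hd l) - real t)\<^sup>2) / (2 * b) + b / 2"
    by (subst Bochner_Integration.integral_add) auto
  also have "\<dots> \<le> b\<^sup>2 / (2 * b) + b / 2"
    using second_moment_le[of t] b by (intro add_right_mono divide_right_mono) (auto simp: b_def power_mult_distrib)
  also have "\<dots> = b" using b by (simp add: power2_eq_square)
  finally show ?thesis by (simp add: b_def)
qed simp

text \<open>The corrector \<^term>\<open>G\<close> cancels the quadratic term of the one-step expansion, so that
  \<open>exp_H\<close> is a martingale up to an error of order \<open>u\<^sup>3\<close>.\<close>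

definition exp_H :: "real \<Rightarrow> nat \<Rightarrow> int \<Rightarrow> complex" where
  "exp_H u t n = exp (Complex (u\<^sup>2 / 2 * G n) (u * (H n - real t)))"

text \<open>The constant of \<open>exp_quadratic_remainder\<close> for the bound
  \<open>C + 1\<close>: a step to the left changes \<open>H - t\<close> by as much as
  \<open>C + 1\<close>.\<close>

definition "Kexp = 5 * (C + 1) ^ 3 * exp (C + 1)"

text \<open>\<open>P\<close> and \<open>Q\<close> are the quadratic expansions of the factors gained
  by a jump to the right and to the left. Their average is exactly 1: the imaginary part vanishes by
  \<open>mu_eq\<close>, the quadratic real part by \<open>g_eq\<close>. Only the two cubic
  remainders survive.\<close>

lemma exp_H_step:
  assumes u: "\<bar>u\<bar> \<le> 1"
  shows "cmod (a n *\<^sub>R exp_H u (Suc t) (n + 1) + (1 - a n) *\<^sub>R exp_H u (Suc t) (n - 1) - exp_H u t n)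
     \<le> cmod (exp_H u t n) * (Kexp * \<bar>u\<bar> ^ 3)"
proof -
  define D e D' e' where "D = \<mu> n - 1" and "e = g n" and "D' = - \<mu> (n - 1) - 1" and "e' = - g (n - 1)"
  define x y P Q where "x = exp (Complex (u\<^sup>2 / 2 * e) (u * D))"
    and "y = exp (Complex (u\<^sup>2 / 2 * e') (u * D'))"
    and "P = Complex (1 + u\<^sup>2 / 2 * (e - D\<^sup>2)) (u * D)"
    and "Q = Complex (1 + u\<^sup>2 / 2 * (e' - D'\<^sup>2)) (u * D')"
  have x: "cmod (x - P) \<le> Kexp * \<bar>u\<bar> ^ 3"
    unfolding x_def P_def Kexp_def using mu_ge_1[of n] mu_le[of n] g_nonneg[of n] g_le[of n] C_ge_1 u
    by (intro exp_quadratic_remainder) (auto simp: D_def e_def)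
  have y: "cmod (y - Q) \<le> Kexp * \<bar>u\<bar> ^ 3"
    unfolding y_def Q_def Kexp_def
    using mu_ge_1[of "n-1"] mu_le[of "n-1"] g_nonneg[of "n-1"] g_le[of "n-1"] C_ge_1 u
    by (intro exp_quadratic_remainder) (auto simp: D'_def e'_def)
  have Re0: "a n * (e - D\<^sup>2) + (1 - a n) * (e' - D'\<^sup>2) = 0"
    using mu_eq[of n] g_eq[of n] unfolding D_def e_def D'_def e'_def by algebra
  have Im0: "a n * D + (1 - a n) * D' = 0"
    using mu_eq[of n] unfolding D_def D'_def by algebra
  have "Re (a n *\<^sub>R P + (1 - a n) *\<^sub>R Q) = 1 + u\<^sup>2 / 2 * (a n * (e - D\<^sup>2) + (1 - a n) * (e' - D'\<^sup>2))"
    by (simp add: P_def Q_def field_simps)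
  moreover have "Im (a n *\<^sub>R P + (1 - a n) *\<^sub>R Q) = u * (a n * D + (1 - a n) * D')"
    by (simp add: P_def Q_def algebra_simps)
  ultimately have PQ: "a n *\<^sub>R P + (1 - a n) *\<^sub>R Q = 1" by (simp add: Re0 Im0 complex_eq_iff)
  have 1: "exp_H u (Suc t) (n + 1) = exp_H u t n * x"
    unfolding exp_H_def x_def D_def e_def exp_add[symmetric]
    by (rule arg_cong[of _ _ exp]) (simp add: complex_eq_iff isum_Suc ring_distribs add_divide_distrib)
  have 2: "exp_H u (Suc t) (n - 1) = exp_H u t n * y"
    unfolding exp_H_def y_def D'_def e'_def exp_add[symmetric]
    by (rule arg_cong[of _ _ exp]) (simp add: complex_eq_iff isum_pred ring_distribs add_divide_distrib diff_divide_distrib)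
  have "a n *\<^sub>R exp_H u (Suc t) (n + 1) + (1 - a n) *\<^sub>R exp_H u (Suc t) (n - 1) - exp_H u t n
     = exp_H u t n * (a n *\<^sub>R x + (1 - a n) *\<^sub>R y - (a n *\<^sub>R P + (1 - a n) *\<^sub>R Q))"
    unfolding 1 2 PQ by (simp add: algebra_simps)
  also have "\<dots> = exp_H u t n * (a n *\<^sub>R (x - P) + (1 - a n) *\<^sub>R (y - Q))"
    by (simp add: algebra_simps)
  also have "cmod \<dots> \<le> cmod (exp_H u t n) * (a n * (Kexp * \<bar>u\<bar> ^ 3) + (1 - a n) * (Kexp * \<bar>u\<bar> ^ 3))"
    unfolding norm_mult using x y a_pos[of n] a_less_1[of n]
    by (intro mult_left_mono order_trans[OF norm_triangle_ineq] add_mono) auto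
  finally show ?thesis by (simp add: algebra_simps)
qed

lemma abs_G_le: "\<bar>G n\<bar> \<le> C * \<bar>real_of_int n\<bar>"
  using isum_diff_le[of g C n 0] g_nonneg g_le by simp

lemma exp_H_norm_le:
  assumes "\<bar>n\<bar> \<le> int t" shows "cmod (exp_H u s n) \<le> exp (u\<^sup>2 / 2 * (C * real t))"
proof -
  have "C * \<bar>real_of_int n\<bar> \<le> C * real t" using assms C_ge_1 by (intro mult_left_mono) linarith+
  then have "G n \<le> C * real t" using abs_G_le[of n] by linarith
  then show ?thesis by (simp add: exp_H_def mult_left_mono)
qed

text \<open>The one-step errors add up over \<open>t\<close> steps. The real part of the exponent
  prevents the bound 1 for \<open>exp_H\<close>, but after \<open>t\<close> steps the walk is within
  distance \<open>t\<close> of the origin, so \<open>G\<close> is at most \<open>C * t\<close>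
  there. For \<open>u\<close> of order \<open>1 / sqrt t\<close> the exponential stays bounded and
  the total error is of order \<open>1 / sqrt t\<close>.\<close>

lemma E_exp_H:
  assumes u: "\<bar>u\<bar> \<le> 1"
  shows "cmod (E 0 t (\<lambda>l. exp_H u t (hd l)) - 1) \<le> Kexp * \<bar>u\<bar> ^ 3 * real t * exp (u\<^sup>2 / 2 * (C * real t))"
proof (induction t)
  case 0
  show ?case by (simp add: exp_H_def zero_complex.code[symmetric])
next
  case (Suc t)
  define B where "B = Kexp * \<bar>u\<bar> ^ 3"
  have B: "B \<ge> 0" using C_ge_1 by (simp add: B_def Kexp_def)
  define d where "d n = a n *\<^sub>R exp_H u (Suc t) (n + 1)
    + (1 - a n) *\<^sub>R exp_H u (Suc t) (n - 1) - exp_H u t n" for n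
  define e0 e1 where "e0 = E 0 t (\<lambda>l. exp_H u t (hd l))"
    and "e1 = E 0 (Suc t) (\<lambda>l. exp_H u (Suc t) (hd l))"
  have "e1 - e0 = E 0 t (\<lambda>l. d (hd l))"
    unfolding e0_def e1_def E_Suc d_def by (subst Bochner_Integration.integral_diff) auto
  then have "cmod (e1 - e0) \<le> E 0 t (\<lambda>l. cmod (d (hd l)))"
    by (simp only: integral_norm_bound)
  also have "\<dots> \<le> E 0 t (\<lambda>l. exp (u\<^sup>2 / 2 * (C * real t)) * B)"
  proof (rule E_mono)
    fix l assume "l \<in> set_pmf (path_pmf a 0 t)"
    then have "\<bar>hd l\<bar> \<le> int t" using hd_path_pmf by fastforce
    then have "cmod (exp_H u t (hd l)) * B \<le> exp (u\<^sup>2 / 2 * (C * real t)) * B"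
      using B by (intro mult_right_mono exp_H_norm_le)
    with exp_H_step[OF u, of "hd l" t] show "cmod (d (hd l)) \<le> exp (u\<^sup>2 / 2 * (C * real t)) * B"
      unfolding B_def d_def by (rule order_trans)
  qed
  finally have 1: "cmod (e1 - e0) \<le> B * exp (u\<^sup>2 / 2 * (C * real t))"
    by (simp add: mult.commute)
  have "cmod (e0 - 1) \<le> B * real t * exp (u\<^sup>2 / 2 * (C * real t))"
    using Suc unfolding B_def e0_def .
  then have "cmod (e1 - 1) \<le> B * exp (u\<^sup>2 / 2 * (C * real t)) + B * real t * exp (u\<^sup>2 / 2 * (C * real t))"
    using norm_triangle_ineq[of "e1 - e0" "e0 - 1"] 1 by simp
  also have "\<dots> = B * real (Suc t) * exp (u\<^sup>2 / 2 * (C * real t))" by (simp add: algebra_simps)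
  also have "\<dots> \<le> B * real (Suc t) * exp (u\<^sup>2 / 2 * (C * real (Suc t)))"
    using B C_ge_1 by (intro mult_left_mono) (auto intro!: mult_left_mono)
  finally show ?case unfolding B_def e1_def .
qed

end

section \<open>The quenched central limit theorem\<close>

lemma norm_iexp_diff_le: "cmod (iexp x - iexp y) \<le> \<bar>x - y\<bar>"
proof -
  have "iexp x - iexp y = iexp y * (iexp (x - y) - 1)"
    by (simp add: algebra_simps flip: exp_add)
  moreover have "cmod (iexp (x - y) - 1) \<le> \<bar>x - y\<bar>"
    using iexp_approx1[of "x - y" 0] by simp
  ultimately show ?thesis by (simp add: norm_mult)
qed

lemma divide_sqrt_split:
  assumes "t \<noteq> 0"
  shows "(d * real t + k * sqrt (real t)) / real t = d + k / sqrt (real t)"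
proof -
  define q where "q = sqrt (real t)"
  have "q > 0" "real t = q * q" using assms by (auto simp: q_def)
  then show ?thesis unfolding q_def[symmetric] by (simp add: field_simps)
qed

lemma cdf_std_normal: "cdf std_normal_distribution x = Phi x"
proof -
  interpret real_distribution std_normal_distribution by (rule real_dist_normal_dist)
  have "cdf std_normal_distribution x = (\<integral>u. indicator {..x} u \<partial>std_normal_distribution)"
    by (simp add: cdf_def)
  also have "\<dots> = (\<integral>u. std_normal_density u *\<^sub>R indicator {..x} u \<partial>lborel)"
    by (rule integral_density) auto
  also have "\<dots> = (\<integral>u. 1 / sqrt (2 * pi) * (indicator {..x} u * exp (- u\<^sup>2 / 2)) \<partial>lborel)"
    by (intro Bochner_Integration.integral_cong) (auto simp: std_normal_density_def)
  also have "\<dots> = Phi x" by (simp add: Phi_def set_lebesgue_integral_def)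
  finally show ?thesis .
qed

lemma continuous_Phi: "isCont Phi x"
proof -
  interpret real_distribution std_normal_distribution by (rule real_dist_normal_dist)
  have "emeasure std_normal_distribution {x} = (\<integral>\<^sup>+ u. ennreal (std_normal_density u) * indicator {x} u \<partial>lborel)"
    by (rule emeasure_density) auto
  also have "\<dots> = 0"
    by (subst nn_integral_0_iff_AE) (auto intro!: AE_I[of _ _ "{x}"] split: split_indicator_asm)
  finally have "measure std_normal_distribution {x} = 0" by (simp add: measure_def)
  then show ?thesis unfolding cdf_std_normal[abs_def, symmetric] isCont_cdf by simp
qed

text \<open>\<open>s2\<close> is the asymptotic variance of the martingale per unit of time. In
  \<open>uniform\<close> the constant \<open>K\<close> is the same for all windows, wherever they
  lie, whereas \<open>G_lim\<close> speaks of nonnegative sites only. Of the centering just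
  \<open>b_close\<close> is recorded.\<close>

locale centered_walk = drift_walk +
  fixes m s2 :: real and b :: "nat \<Rightarrow> int"
  assumes m_pos: "0 < m" and s2_pos: "0 < s2"
    and uniform: "0 < \<delta> \<Longrightarrow> \<exists>K. \<forall>i j. i \<le> j \<longrightarrow>
       \<bar>(\<Sum>k\<in>{i..<j}. \<mu> k) - m * real_of_int (j - i)\<bar> \<le> \<delta> * real_of_int (j - i) + K"
    and G_lim: "(\<lambda>n. (G (int n) - s2 * H (int n)) / real n) \<longlonglongrightarrow> 0"
    and b_close: "\<bar>H (b t) - real t\<bar> \<le> C"
begin

section \<open>Approximations in mean\<close>

lemma abs_H_le: "\<bar>H n\<bar> \<le> C * \<bar>real_of_int n\<bar>"
proof -
  have "\<bar>\<mu> k\<bar> \<le> C" for k using mu_ge_1[of k] mu_le[of k] by auto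
  from isum_diff_le[of \<mu>, OF this, of n 0] show ?thesis by simp
qed

text \<open>\<open>G_lim\<close> covers the sites \<open>n \<ge> 0\<close>. For negative
  \<open>n\<close> the bound \<open>H n \<le> n\<close> gives
  \<open>\<bar>n\<bar> \<le> \<bar>H n - t\<bar>\<close>, so the crude linear bound for
  \<open>G\<close> and \<open>H\<close> is absorbed by the deviation of the martingale;
  \<open>C + s2 * C\<close> is the sum of the two slopes.\<close>

lemma G_minus_H_bound:
  assumes \<delta>: "\<delta> > 0"
  shows "\<exists>K\<ge>0. \<forall>t n. \<bar>n\<bar> \<le> int t \<longrightarrow>
    \<bar>G n - s2 * H n\<bar> \<le> \<delta> * real t + K + (C + s2 * C) * \<bar>H n - real t\<bar>"
proof -
  obtain K where K: "K \<ge> 0" "\<And>n. \<bar>G (int n) - s2 * H (int n)\<bar> \<le> \<delta> * real n + K"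
    using sublinear_bound[OF G_lim \<delta>] by auto
  have C': "0 \<le> C + s2 * C" using C_ge_1 s2_pos by simp
  have "\<bar>G n - s2 * H n\<bar> \<le> \<delta> * real t + K + (C + s2 * C) * \<bar>H n - real t\<bar>"
    if n: "\<bar>n\<bar> \<le> int t" for t n
  proof (cases "0 \<le> n")
    case True
    then obtain k where k: "n = int k" by (metis nonneg_int_cases)
    have "\<bar>G n - s2 * H n\<bar> \<le> \<delta> * real k + K" using K(2)[of k] k by simp
    also have "\<delta> * real k \<le> \<delta> * real t" using n k \<delta> by simp
    moreover have "0 \<le> (C + s2 * C) * \<bar>H n - real t\<bar>" using C' by (intro mult_nonneg_nonneg) auto
    ultimately show ?thesis by linarith
  next
    case False
    have "\<bar>real_of_int n\<bar> \<le> \<bar>H n - real t\<bar>"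
      using isum_diff_ge[of \<mu>, OF mu_ge_1, of n 0] False by simp
    then have "(C + s2 * C) * \<bar>real_of_int n\<bar> \<le> (C + s2 * C) * \<bar>H n - real t\<bar>"
      using C' by (intro mult_left_mono)
    moreover have "\<bar>G n - s2 * H n\<bar> \<le> (C + s2 * C) * \<bar>real_of_int n\<bar>"
    proof -
      have "s2 * \<bar>H n\<bar> \<le> s2 * (C * \<bar>real_of_int n\<bar>)" using s2_pos abs_H_le by (intro mult_left_mono) auto
      moreover have "\<bar>s2 * H n\<bar> = s2 * \<bar>H n\<bar>" using s2_pos by (simp add: abs_mult)
      ultimately show ?thesis using abs_G_le[of n] by (simp add: algebra_simps)
    qed
    moreover have "0 \<le> \<delta> * real t" using \<delta> by simp
    ultimately show ?thesis using K(1) by linarith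
  qed
  with K(1) show ?thesis by blast
qed

lemma G_minus_H_limit: "(\<lambda>t. E 0 t (\<lambda>l. \<bar>G (hd l) - s2 * H (hd l)\<bar>) / real t) \<longlonglongrightarrow> 0"
proof (rule tendsto_zero_sqrtI[where c = 1])
  fix \<delta> :: real assume "\<delta> > 0"
  then obtain K where K: "K \<ge> 0" "\<And>t n. \<bar>n\<bar> \<le> int t \<Longrightarrow>
    \<bar>G n - s2 * H n\<bar> \<le> \<delta> * real t + K + (C + s2 * C) * \<bar>H n - real t\<bar>"
    using G_minus_H_bound by blast
  have C': "0 \<le> C + s2 * C" using C_ge_1 s2_pos by simp
  show "\<exists>K. \<forall>t\<ge>1. E 0 t (\<lambda>l. \<bar>G (hd l) - s2 * H (hd l)\<bar>) / real t \<le> \<delta> * 1 + K / sqrt (real t)"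
  proof (intro exI allI impI)
    fix t :: nat assume t: "t \<ge> 1"
    have "E 0 t (\<lambda>l. \<bar>G (hd l) - s2 * H (hd l)\<bar>)
      \<le> E 0 t (\<lambda>l. (\<delta> * real t + K) + (C + s2 * C) * \<bar>H (hd l) - real t\<bar>)"
      using hd_path_pmf[of _ a 0 t] by (intro E_mono K(2)) auto
    also have "\<dots> = (\<delta> * real t + K) + (C + s2 * C) * E 0 t (\<lambda>l. \<bar>H (hd l) - real t\<bar>)"
      by (subst Bochner_Integration.integral_add) auto
    also have "\<dots> \<le> (\<delta> * real t + K) + (C + s2 * C) * (C * sqrt (real t))"
      using first_moment_le C' by (intro add_left_mono mult_left_mono)
    also have "\<dots> \<le> \<delta> * real t + (K + (C + s2 * C) * C) * sqrt (real t)"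
    proof -
      have "K * 1 \<le> K * sqrt (real t)" using K(1) t by (intro mult_left_mono) auto
      then show ?thesis by (simp add: algebra_simps)
    qed
    finally have "E 0 t (\<lambda>l. \<bar>G (hd l) - s2 * H (hd l)\<bar>) / real t
       \<le> (\<delta> * real t + (K + (C + s2 * C) * C) * sqrt (real t)) / real t"
      by (rule divide_right_mono) simp
    also have "\<dots> = \<delta> * 1 + (K + (C + s2 * C) * C) / sqrt (real t)"
      using t by (simp add: divide_sqrt_split)
    finally show "E 0 t (\<lambda>l. \<bar>G (hd l) - s2 * H (hd l)\<bar>) / real t
       \<le> \<delta> * 1 + (K + (C + s2 * C) * C) / sqrt (real t)" .
  qed
qed auto

lemma H_limit: "(\<lambda>t. E 0 t (\<lambda>l. \<bar>H (hd l) - real t\<bar>) / real t) \<longlonglongrightarrow> 0"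
proof (rule tendsto_zero_sqrtI[where c = 1])
  fix \<delta> :: real assume \<delta>: "\<delta> > 0"
  show "\<exists>K. \<forall>t\<ge>1. E 0 t (\<lambda>l. \<bar>H (hd l) - real t\<bar>) / real t \<le> \<delta> * 1 + K / sqrt (real t)"
  proof (intro exI allI impI)
    fix t :: nat assume t: "t \<ge> 1"
    have "E 0 t (\<lambda>l. \<bar>H (hd l) - real t\<bar>) / real t \<le> C * sqrt (real t) / real t"
      by (intro divide_right_mono first_moment_le) auto
    also have "\<dots> = C / sqrt (real t)"
      using t by (simp add: field_simps flip: power2_eq_square)
    finally show "E 0 t (\<lambda>l. \<bar>H (hd l) - real t\<bar>) / real t \<le> \<delta> * 1 + C / sqrt (real t)"
      using \<delta> by linarith
  qed
qed auto

text \<open>\<open>uniform\<close> is applied to the window between \<open>b t\<close> and the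
  current site. As \<open>\<mu> \<ge> 1\<close>, the length of the window is at most the increment
  of \<open>H\<close> over it, hence at most \<open>\<bar>H - t\<bar> + C\<close>, whose mean is of
  order \<open>sqrt t\<close>.\<close>

lemma linearization_limit:
  "(\<lambda>t. E 0 t (\<lambda>l. \<bar>m * real_of_int (hd l - b t) - (H (hd l) - real t)\<bar>) / sqrt (real t)) \<longlonglongrightarrow> 0"
\<comment> \<open>One \<open>C\<close> comes from the mean of \<open>\<bar>H - t\<bar>\<close>, the
  other from the offset in \<open>b_close\<close>, which is enlarged by the factor
  \<open>sqrt t \<ge> 1\<close>.\<close>
proof (rule tendsto_zero_sqrtI[where c = "2 * C"])
  show "0 \<le> 2 * C" using C_ge_1 by simp
  fix \<delta> :: real assume \<delta>: "\<delta> > 0"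
  obtain K where K: "\<And>i j. i \<le> j \<Longrightarrow>
       \<bar>(\<Sum>k\<in>{i..<j}. \<mu> k) - m * real_of_int (j - i)\<bar> \<le> \<delta> * real_of_int (j - i) + K"
    using uniform[OF \<delta>] by blast
  have lin: "\<bar>m * real_of_int (n - b t) - (H n - real t)\<bar> \<le> \<delta> * \<bar>H n - real t\<bar> + (\<delta> * C + K + C)" for n t
  proof -
    have "\<bar>m * real_of_int (n - b t) - (H n - H (b t))\<bar> \<le> \<delta> * \<bar>real_of_int (n - b t)\<bar> + K"
    proof (cases "b t \<le> n")
      case True
      then show ?thesis using K[OF True] isum_diff[OF True, of \<mu>] by (simp add: abs_minus_commute)
    next
      case False
      then have le: "n \<le> b t" by simp
      have "m * real_of_int (n - b t) - (H n - H (b t)) = (\<Sum>k\<in>{n..<b t}. \<mu> k) - m * real_of_int (b t - n)"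
        using isum_diff[OF le, of \<mu>] by (simp add: algebra_simps)
      moreover have "\<bar>real_of_int (n - b t)\<bar> = real_of_int (b t - n)" using le by simp
      ultimately show ?thesis using K[OF le] by (simp only:)
    qed
    moreover have "\<delta> * \<bar>real_of_int (n - b t)\<bar> \<le> \<delta> * (\<bar>H n - real t\<bar> + C)"
      using isum_abs_diff_ge[of \<mu>, OF mu_ge_1, of n "b t"] b_close[of t] \<delta>
      by (intro mult_left_mono) linarith+
    ultimately show ?thesis using b_close[of t] by (simp add: algebra_simps)
  qed
  show "\<exists>K. \<forall>t\<ge>1. E 0 t (\<lambda>l. \<bar>m * real_of_int (hd l - b t) - (H (hd l) - real t)\<bar>) / sqrt (real t)
      \<le> \<delta> * (2 * C) + K / sqrt (real t)"
  proof (intro exI allI impI)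
    fix t :: nat assume t: "t \<ge> 1"
    have "E 0 t (\<lambda>l. \<bar>m * real_of_int (hd l - b t) - (H (hd l) - real t)\<bar>)
      \<le> E 0 t (\<lambda>l. \<delta> * \<bar>H (hd l) - real t\<bar> + (\<delta> * C + K + C))"
      by (intro E_mono lin)
    also have "\<dots> = \<delta> * E 0 t (\<lambda>l. \<bar>H (hd l) - real t\<bar>) + (\<delta> * C + K + C)"
      by (subst Bochner_Integration.integral_add) auto
    also have "\<dots> \<le> \<delta> * (C * sqrt (real t)) + (\<delta> * C * sqrt (real t) + K + C)"
    proof -
      have "\<delta> * E 0 t (\<lambda>l. \<bar>H (hd l) - real t\<bar>) \<le> \<delta> * (C * sqrt (real t))"
        using first_moment_le \<delta> by (intro mult_left_mono) auto
      moreover have "\<delta> * C * 1 \<le> \<delta> * C * sqrt (real t)" using \<delta> C_ge_1 t by (intro mult_left_mono) auto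
      ultimately show ?thesis by linarith
    qed
    finally have "E 0 t (\<lambda>l. \<bar>m * real_of_int (hd l - b t) - (H (hd l) - real t)\<bar>) / sqrt (real t)
      \<le> (\<delta> * (C * sqrt (real t)) + (\<delta> * C * sqrt (real t) + K + C)) / sqrt (real t)"
      by (rule divide_right_mono) simp
    also have "\<dots> = \<delta> * (2 * C) + (K + C) / sqrt (real t)"
      using t by (simp add: field_simps)
    finally show "E 0 t (\<lambda>l. \<bar>m * real_of_int (hd l - b t) - (H (hd l) - real t)\<bar>) / sqrt (real t)
      \<le> \<delta> * (2 * C) + (K + C) / sqrt (real t)" .
  qed
qed auto

section \<open>Characteristic functions and the limit law\<close>

lemma E_exp_H_limit: "(\<lambda>t. E 0 t (\<lambda>l. exp_H (w / sqrt (real t)) t (hd l))) \<longlonglongrightarrow> 1"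
proof -
  define B where "B = Kexp * \<bar>w\<bar> ^ 3 * exp (w\<^sup>2 / 2 * C)"
  have "(\<lambda>t. E 0 t (\<lambda>l. exp_H (w / sqrt (real t)) t (hd l)) - 1) \<longlonglongrightarrow> 0"
  proof (rule Lim_null_comparison)
    show "(\<lambda>t. B / sqrt (real t)) \<longlonglongrightarrow> 0"
      by (rule real_tendsto_divide_at_top[OF tendsto_const
          filterlim_compose[OF sqrt_at_top filterlim_real_sequentially]])
    obtain N :: nat where N: "max 1 (w\<^sup>2) \<le> real N" using real_arch_simple by blast
    show "\<forall>\<^sub>F t in sequentially. cmod (E 0 t (\<lambda>l. exp_H (w / sqrt (real t)) t (hd l)) - 1) \<le> B / sqrt (real t)"
      using eventually_ge_at_top[of N]
    proof eventually_elim
      case (elim t)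
      define q where "q = sqrt (real t)"
      have t: "real t \<ge> 1" "w\<^sup>2 \<le> real t" using N elim by auto
      then have q: "q > 0" "q\<^sup>2 = real t" by (auto simp: q_def)
      have "\<bar>w\<bar> \<le> q" using t(2) by (simp add: q_def real_le_rsqrt)
      then have u: "\<bar>w / q\<bar> \<le> 1" using q by (simp add: field_simps)
      have "Kexp * \<bar>w / q\<bar> ^ 3 * real t * exp ((w / q)\<^sup>2 / 2 * (C * real t)) = B / q"
        unfolding q(2)[symmetric] B_def using q(1) by (simp add: power_divide field_simps eval_nat_numeral)
      with E_exp_H[OF u, of t] show ?case by (simp add: q_def)
    qed
  qed
  then show ?thesis by (simp add: LIM_zero_iff)
qed

text \<open>The modulus \<open>exp (y n)\<close> of \<open>exp_H\<close> is replaced by the constant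
  \<open>c\<close>. The error is controlled by \<open>\<bar>s2 - G / t\<bar>\<close>, which is small
  in mean because \<open>G\<close> is close to \<open>s2 * H\<close> and \<open>H\<close> is close
  to \<open>t\<close>. Dividing the limit 1 by \<open>c\<close> leaves the Gaussian
  transform.\<close>

lemma martingale_char_limit:
  "(\<lambda>t. E 0 t (\<lambda>l. iexp (w * (H (hd l) - real t) / sqrt (real t)))) \<longlonglongrightarrow> exp (- (w\<^sup>2 * s2 / 2))"
proof -
  \<comment> \<open>A common upper bound for \<open>s2\<close> and for \<open>G n / t\<close> at all
    sites reachable by time \<open>t\<close>; below it the exponential is Lipschitz.\<close>
  define K where "K = max C s2"
  define c where "c = exp (w\<^sup>2 * s2 / 2)"
  define B where "B = exp (w\<^sup>2 / 2 * K) * (w\<^sup>2 / 2)"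
  define e where "e t = E 0 t (\<lambda>l. iexp (w * (H (hd l) - real t) / sqrt (real t)))" for t
  have "(\<lambda>t. complex_of_real c * e t - E 0 t (\<lambda>l. exp_H (w / sqrt (real t)) t (hd l))) \<longlonglongrightarrow> 0"
  proof (rule Lim_null_comparison)
    show "(\<lambda>t. B * (E 0 t (\<lambda>l. \<bar>G (hd l) - s2 * H (hd l)\<bar>) / real t
         + s2 * (E 0 t (\<lambda>l. \<bar>H (hd l) - real t\<bar>) / real t))) \<longlonglongrightarrow> 0"
      using tendsto_mult[OF tendsto_const tendsto_add[OF G_minus_H_limit
            tendsto_mult[OF tendsto_const[of s2] H_limit]], of B] by simp
    show "\<forall>\<^sub>F t in sequentially.
      cmod (complex_of_real c * e t - E 0 t (\<lambda>l. exp_H (w / sqrt (real t)) t (hd l)))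
       \<le> B * (E 0 t (\<lambda>l. \<bar>G (hd l) - s2 * H (hd l)\<bar>) / real t
         + s2 * (E 0 t (\<lambda>l. \<bar>H (hd l) - real t\<bar>) / real t))"
      using eventually_ge_at_top[of 1]
    proof eventually_elim
      case (elim t)
      then have t: "real t > 0" by simp
      define x where "x n = w * (H n - real t) / sqrt (real t)" for n
      define y where "y n = w\<^sup>2 / 2 * (G n / real t)" for n
      have eq: "exp_H (w / sqrt (real t)) t n = complex_of_real (exp (y n)) * iexp (x n)" for n
      proof -
        have "Complex ((w / sqrt (real t))\<^sup>2 / 2 * G n) (w / sqrt (real t) * (H n - real t))
           = complex_of_real (y n) + \<i> * complex_of_real (x n)"
          using t by (simp add: complex_eq_iff x_def y_def power_divide)
        then show ?thesis by (simp add: exp_H_def exp_add exp_of_real)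
      qed
      have "complex_of_real c * e t - E 0 t (\<lambda>l. exp_H (w / sqrt (real t)) t (hd l))
          = E 0 t (\<lambda>l. complex_of_real (c - exp (y (hd l))) * iexp (x (hd l)))"
      proof -
        have "E 0 t (\<lambda>l. complex_of_real (c - exp (y (hd l))) * iexp (x (hd l)))
          = E 0 t (\<lambda>l. complex_of_real c * iexp (x (hd l)) - complex_of_real (exp (y (hd l))) * iexp (x (hd l)))"
          by (simp only: of_real_diff left_diff_distrib)
        also have "\<dots> = E 0 t (\<lambda>l. complex_of_real c * iexp (x (hd l)))
            - E 0 t (\<lambda>l. complex_of_real (exp (y (hd l))) * iexp (x (hd l)))"
          by (rule Bochner_Integration.integral_diff) (rule integrable_path)+
        also have "E 0 t (\<lambda>l. complex_of_real c * iexp (x (hd l))) = complex_of_real c * e t"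
          unfolding e_def x_def by (rule integral_mult_right_zero)
        finally show ?thesis unfolding eq by simp
      qed
      then have "cmod (complex_of_real c * e t - E 0 t (\<lambda>l. exp_H (w / sqrt (real t)) t (hd l)))
        \<le> E 0 t (\<lambda>l. cmod (complex_of_real (c - exp (y (hd l))) * iexp (x (hd l))))"
        by (simp only: integral_norm_bound)
      also have "\<dots> \<le> E 0 t (\<lambda>l. B * (\<bar>G (hd l) - s2 * H (hd l)\<bar> / real t + s2 * (\<bar>H (hd l) - real t\<bar> / real t)))"
      proof (rule E_mono)
        fix l assume "l \<in> set_pmf (path_pmf a 0 t)"
        then have n: "\<bar>hd l\<bar> \<le> int t" using hd_path_pmf by fastforce
        define n where "n = hd l"
        have "\<bar>real_of_int n\<bar> \<le> real t" using n unfolding n_def by linarith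
        then have "C * \<bar>real_of_int n\<bar> \<le> C * real t" using C_ge_1 by (intro mult_left_mono) auto
        with abs_G_le[of n] have "G n \<le> C * real t" by linarith
        then have "G n / real t \<le> C" using t by (simp add: field_simps)
        then have GK: "G n / real t \<le> K" by (simp add: K_def)
        have "\<bar>c - exp (y n)\<bar> \<le> exp (w\<^sup>2 / 2 * K) * \<bar>w\<^sup>2 * s2 / 2 - y n\<bar>"
          unfolding c_def
        proof (rule exp_diff_le)
          show "w\<^sup>2 * s2 / 2 \<le> w\<^sup>2 / 2 * K" by (simp add: K_def mult_left_mono)
          show "y n \<le> w\<^sup>2 / 2 * K" unfolding y_def using GK by (intro mult_left_mono) auto
        qed
        also have "w\<^sup>2 * s2 / 2 - y n = w\<^sup>2 / 2 * (s2 - G n / real t)" by (simp add: y_def algebra_simps)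
        also have "exp (w\<^sup>2 / 2 * K) * \<bar>\<dots>\<bar> = B * \<bar>s2 - G n / real t\<bar>" by (simp add: B_def abs_mult)
        also have "\<dots> \<le> B * (\<bar>G n - s2 * H n\<bar> / real t + s2 * (\<bar>H n - real t\<bar> / real t))"
        proof (rule mult_left_mono)
          have "s2 - G n / real t = - ((G n - s2 * H n) / real t) - s2 * ((H n - real t) / real t)"
            using t by (simp add: field_simps)
          moreover have "\<bar>- p - q\<bar> \<le> \<bar>p\<bar> + \<bar>q\<bar>" for p q :: real by linarith
          ultimately have "\<bar>s2 - G n / real t\<bar> \<le> \<bar>(G n - s2 * H n) / real t\<bar> + \<bar>s2 * ((H n - real t) / real t)\<bar>"
            by (simp only:)
          then show "\<bar>s2 - G n / real t\<bar> \<le> \<bar>G n - s2 * H n\<bar> / real t + s2 * (\<bar>H n - real t\<bar> / real t)"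
            using s2_pos t by (simp add: abs_mult)
        qed (simp add: B_def)
        finally show "cmod (complex_of_real (c - exp (y (hd l))) * iexp (x (hd l)))
          \<le> B * (\<bar>G (hd l) - s2 * H (hd l)\<bar> / real t + s2 * (\<bar>H (hd l) - real t\<bar> / real t))"
          by (simp add: norm_mult n_def del: of_real_diff)
      qed
      also have "\<dots> = B * (E 0 t (\<lambda>l. \<bar>G (hd l) - s2 * H (hd l)\<bar>) / real t
         + s2 * (E 0 t (\<lambda>l. \<bar>H (hd l) - real t\<bar>) / real t))"
        by (simp add: Bochner_Integration.integral_add)
      finally show ?case .
    qed
  qed
  from tendsto_add[OF this E_exp_H_limit[of w]] have "(\<lambda>t. complex_of_real c * e t) \<longlonglongrightarrow> 1" by simp
  then have "(\<lambda>t. complex_of_real (inverse c) * (complex_of_real c * e t)) \<longlonglongrightarrow> complex_of_real (inverse c) * 1"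
    by (intro tendsto_mult tendsto_const)
  moreover have "c > 0" by (simp add: c_def)
  then have "complex_of_real (inverse c) * (complex_of_real c * e t) = e t" for t by simp
  moreover have "inverse c = exp (- (w\<^sup>2 * s2 / 2))" by (simp add: c_def exp_minus)
  ultimately show ?thesis by (simp only: e_def mult_1_right)
qed

text \<open>With \<open>w = \<theta> / sqrt s2\<close> the two arguments of \<open>iexp\<close>
  differ exactly by \<open>w / sqrt t\<close> times the linearization error, and \<open>iexp\<close>
  is 1-Lipschitz.\<close>

lemma char_limit:
  "(\<lambda>t. E 0 t (\<lambda>l. iexp (\<theta> * (real_of_int (hd l - b t) / (sqrt (real t) * (sqrt s2 / m))))))
    \<longlonglongrightarrow> exp (- \<theta>\<^sup>2 / 2)"
proof -
  define w where "w = \<theta> / sqrt s2"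
  have w: "w\<^sup>2 * s2 = \<theta>\<^sup>2" using s2_pos by (simp add: w_def power_divide)
  define x where "x t n = \<theta> * (real_of_int (n - b t) / (sqrt (real t) * (sqrt s2 / m)))" for t n
  define y where "y t n = w * (H n - real t) / sqrt (real t)" for t n
  have "(\<lambda>t. E 0 t (\<lambda>l. iexp (x t (hd l))) - E 0 t (\<lambda>l. iexp (y t (hd l)))) \<longlonglongrightarrow> 0"
  proof (rule Lim_null_comparison)
    show "(\<lambda>t. \<bar>w\<bar> * (E 0 t (\<lambda>l. \<bar>m * real_of_int (hd l - b t) - (H (hd l) - real t)\<bar>) / sqrt (real t))) \<longlonglongrightarrow> 0"
      using tendsto_mult[OF tendsto_const linearization_limit] by simp
    have "cmod (E 0 t (\<lambda>l. iexp (x t (hd l))) - E 0 t (\<lambda>l. iexp (y t (hd l))))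
      \<le> \<bar>w\<bar> * (E 0 t (\<lambda>l. \<bar>m * real_of_int (hd l - b t) - (H (hd l) - real t)\<bar>) / sqrt (real t))" for t
    proof -
      have "E 0 t (\<lambda>l. iexp (x t (hd l))) - E 0 t (\<lambda>l. iexp (y t (hd l)))
         = E 0 t (\<lambda>l. iexp (x t (hd l)) - iexp (y t (hd l)))"
        by (subst Bochner_Integration.integral_diff) auto
      then have "cmod (E 0 t (\<lambda>l. iexp (x t (hd l))) - E 0 t (\<lambda>l. iexp (y t (hd l))))
         \<le> E 0 t (\<lambda>l. cmod (iexp (x t (hd l)) - iexp (y t (hd l))))"
        by (simp only: integral_norm_bound)
      also have "\<dots> \<le> E 0 t (\<lambda>l. \<bar>w\<bar> / sqrt (real t) * \<bar>m * real_of_int (hd l - b t) - (H (hd l) - real t)\<bar>)"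
      proof (rule E_mono)
        fix l
        have "x t (hd l) - y t (hd l) = w / sqrt (real t) * (m * real_of_int (hd l - b t) - (H (hd l) - real t))"
          using m_pos s2_pos by (simp add: x_def y_def w_def field_simps)
            (simp add: add_divide_distrib diff_divide_distrib)
        with norm_iexp_diff_le[of "x t (hd l)" "y t (hd l)"]
        show "cmod (iexp (x t (hd l)) - iexp (y t (hd l)))
           \<le> \<bar>w\<bar> / sqrt (real t) * \<bar>m * real_of_int (hd l - b t) - (H (hd l) - real t)\<bar>"
          by (simp only: abs_mult abs_divide abs_of_nonneg[OF real_sqrt_ge_zero[OF of_nat_0_le_iff]])
      qed
      finally show ?thesis by simp
    qed
    then show "\<forall>\<^sub>F t in sequentially. cmod (E 0 t (\<lambda>l. iexp (x t (hd l))) - E 0 t (\<lambda>l. iexp (y t (hd l))))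
      \<le> \<bar>w\<bar> * (E 0 t (\<lambda>l. \<bar>m * real_of_int (hd l - b t) - (H (hd l) - real t)\<bar>) / sqrt (real t))"
      by simp
  qed
  from tendsto_add[OF this martingale_char_limit[of w, folded y_def]]
  show ?thesis by (simp add: x_def w)
qed

text \<open>Levy's continuity theorem applies to the laws \<open>N t\<close> of the normalized end
  points of finite paths. Continuity of \<open>Phi\<close> turns weak convergence into convergence
  at every point.\<close>

theorem clt:
  fixes F :: "nat \<Rightarrow> real \<Rightarrow> real"
  defines "F \<equiv> \<lambda>t x. measure (walk_law a 0)
     {X. (real_of_int (X t) - real_of_int (b t)) / (sqrt (real t) * (sqrt s2 / m)) \<le> x}"
  shows "(\<lambda>t. F t x) \<longlonglongrightarrow> Phi x" and "uniform_limit UNIV F Phi sequentially"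
proof -
  define Z where "Z t l = real_of_int (hd l - b t) / (sqrt (real t) * (sqrt s2 / m))" for t l
  define N where "N t = distr (measure_pmf (path_pmf a 0 t)) borel (Z t)" for t
  have N: "real_distribution (N t)" for t
    unfolding N_def by (rule prob_space.real_distribution_distr[OF prob_space_measure_pmf]) simp
  have F: "F t x = cdf (N t) x" for t x
  proof -
    have "F t x = measure (walk_law a 0) {X. Z t (history t X) \<le> x}"
      by (simp add: F_def Z_def)
    also have "\<dots> = measure (path_pmf a 0 t) {l. Z t l \<le> x}" by (rule measure_history)
    also have "\<dots> = cdf (N t) x"
      unfolding cdf_def N_def by (subst measure_distr) (auto simp: vimage_def)
    finally show ?thesis .
  qed
  have "char (N t) \<theta> = E 0 t (\<lambda>l. iexp (\<theta> * Z t l))" for t \<theta>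
    unfolding char_def N_def by (subst integral_distr) auto
  then have "weak_conv_m N std_normal_distribution"
    using char_limit by (intro levy_continuity N real_dist_normal_dist)
      (simp add: char_std_normal_distribution Z_def)
  then have lim: "(\<lambda>t. F t x) \<longlonglongrightarrow> Phi x" for x
    using continuous_Phi[of x] unfolding weak_conv_m_def weak_conv_def F cdf_std_normal[abs_def] by blast
  then show "(\<lambda>t. F t x) \<longlonglongrightarrow> Phi x" .
  interpret std: real_distribution std_normal_distribution by (rule real_dist_normal_dist)
  have N_cdf: "mono (F t)" "0 \<le> F t x" "F t x \<le> 1" for t x
  proof -
    interpret real_distribution "N t" by (rule N)
    show "mono (F t)" "0 \<le> F t x" "F t x \<le> 1"
      using cdf_nondecreasing cdf_nonneg cdf_bounded_prob by (auto simp: F mono_def)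
  qed
  show "uniform_limit UNIV F Phi sequentially"
  proof (rule polya_uniform_limit[OF N_cdf _ _ _ _ lim])
    show "continuous_on UNIV Phi" by (simp add: continuous_on_eq_continuous_at continuous_Phi)
    show "mono Phi" using std.cdf_nondecreasing by (simp add: cdf_std_normal mono_def)
    show "(Phi \<longlongrightarrow> 0) at_bot" using std.cdf_lim_at_bot unfolding cdf_std_normal[abs_def] .
    show "(Phi \<longlongrightarrow> 1) at_top" using std.cdf_lim_at_top_prob unfolding cdf_std_normal[abs_def] .
  qed
qed

end

section \<open>Mean and variance of the hitting times\<close>

text \<open>The value of \<open>f\<close> along a path (most recent site first) stopped at the first visit
  to \<open>m\<close>.\<close>

primrec stop :: "(nat \<Rightarrow> int \<Rightarrow> real) \<Rightarrow> int \<Rightarrow> int list \<Rightarrow> real" where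
  "stop f m [] = 0"
| "stop f m (v # l) = (if m \<in> set l then stop f m l else f (length l) v)"

text \<open>Separates the paths that have reached \<open>m\<close> from those still under way; the
  second summand is the remainder that has to vanish in optional stopping.\<close>

lemma stop_split:
  assumes "l \<noteq> []"
  shows "stop f m l = stop (\<lambda>s n. if n = m then f s m else 0) m l
     + (if m \<in> set l then 0 else f (length l - 1) (hd l))"
  using assms
proof (induction l)
  case (Cons v l)
  then show ?case by (cases "l = []") auto
qed simp

lemma stop_history:
  assumes "x t = m" "\<And>i. i < t \<Longrightarrow> x i \<noteq> m" "t \<le> N"
  shows "stop f m (history N x) = f t m"
  using assms(3)
proof (induction N rule: dec_induct)
  case base
  show ?case
  proof (cases t)
    case (Suc s)
    have "x i \<noteq> m" if "i \<le> s" for i using assms(2)[of i] that Suc by simp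
    then have "m \<notin> set (history s x)" by (auto simp: set_history)
    with Suc assms(1) show ?thesis by simp
  qed (use assms(1) in simp)
next
  case (step N)
  then have "m \<in> set (history N x)" using assms(1) by (auto simp: set_history)
  with step show ?case by simp
qed

text \<open>The value is 0 before the first visit and frozen at a nonnegative number afterwards;
  this prepares monotone convergence in the time horizon.\<close>

lemma stop_mono:
  assumes "\<And>s. 0 \<le> f s m" "\<And>s n. n \<noteq> m \<Longrightarrow> f s n = 0"
  shows "stop f m (history N x) \<le> stop f m (history (Suc N) x)"
proof (cases "m \<in> set (history N x)")
  case False
  then have "stop f m (history N x) = 0"
    using assms(2) by (cases N) auto
  moreover have "0 \<le> f (Suc N) (x (Suc N))" using assms by (cases "x (Suc N) = m") auto
  ultimately show ?thesis using False by simp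
qed simp

lemma hitting_time_eq:
  "hitting_time m x = (if \<exists>t. x t = m then enat (LEAST t. x t = m) else \<infinity>)"
proof (cases "\<exists>t. x t = m")
  case True
  then have "x (LEAST t. x t = m) = m" by (rule LeastI_ex)
  then have "hitting_time m x = enat (LEAST t. x t = m)"
    unfolding hitting_time_def
    by (intro antisym INF_lower INF_greatest) (auto intro: Least_le)
  with True show ?thesis by simp
next
  case False
  then show ?thesis by (simp add: hitting_time_def top_enat_def)
qed

section \<open>Exponential tails and optional stopping\<close>

context drift_walk
begin

text \<open>The exponential weight contracts by the factor \<open>decay\<close> in each step because \<open>H\<close> has drift
  \<open>1\<close> and bounded increments; this gives exponential tails for the hitting times.\<close>

definition rate :: real where "rate = 1 / (2 * C\<^sup>2)"

definition decay :: real where "decay = 1 - 1 / (4 * C\<^sup>2)"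

definition weight :: "int \<Rightarrow> int \<Rightarrow> real" where "weight m n = exp (rate * (H m - H n))"

lemma weight_nonneg [simp]: "0 \<le> weight m n"
  by (simp add: weight_def)

lemma rate: "0 < rate" "rate * C \<le> 1"
proof -
  show "0 < rate" using C_ge_1 by (simp add: rate_def)
  have "C * 1 \<le> C * (2 * C)" using C_ge_1 by (intro mult_left_mono) auto
  then have "C \<le> 2 * C\<^sup>2" by (simp add: power2_eq_square)
  then show "rate * C \<le> 1" using C_ge_1 by (simp add: rate_def field_simps)
qed

lemma decay: "0 \<le> decay" "decay < 1"
proof -
  have "1 \<le> C\<^sup>2" using C_ge_1 by (simp add: one_le_power)
  then have "1 / (4 * C\<^sup>2) \<le> 1" "0 < 1 / (4 * C\<^sup>2)" by (auto simp: divide_le_eq)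
  then show "0 \<le> decay" "decay < 1" by (auto simp: decay_def)
qed

lemma exp_le_quadratic:
  fixes y :: real
  assumes "\<bar>y\<bar> \<le> 1" shows "exp y \<le> 1 + y + y\<^sup>2"
proof (cases "0 \<le> y")
  case True
  then show ?thesis using assms exp_bound[of y] by simp
next
  case False
  \<comment> \<open>For negative \<open>y\<close> the claim is
    \<open>1 \<le> (1 + y + y^2) * exp (- y)\<close>, which allows a lower Taylor bound for
    \<open>exp\<close> at the positive point \<open>- y\<close>.\<close>
  have "1 \<le> (1 + y + y\<^sup>2) * (1 - y + y\<^sup>2 / 2)"
  proof -
    have "(1 + y + y\<^sup>2) * (1 - y + y\<^sup>2 / 2) - 1 = y\<^sup>2 / 2 * (1 - y + y\<^sup>2)"
      by (simp add: power2_eq_square field_simps)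
    moreover have "0 \<le> y\<^sup>2 / 2 * (1 - y + y\<^sup>2)" using False by (intro mult_nonneg_nonneg) auto
    ultimately show ?thesis by linarith
  qed
  also have "\<dots> \<le> (1 + y + y\<^sup>2) * exp (- y)"
    using exp_lower_Taylor_quadratic[of "- y"] False assms by (intro mult_left_mono) auto
  finally have "1 * exp y \<le> (1 + y + y\<^sup>2) * exp (- y) * exp y" by (intro mult_right_mono) auto
  then show ?thesis by (simp add: mult.assoc flip: exp_add)
qed

lemma weight_step: "a n * weight m (n + 1) + (1 - a n) * weight m (n - 1) \<le> decay * weight m n"
proof -
  define c where "c = rate"
  have small: "\<bar>c * \<mu> j\<bar> \<le> 1" "(c * \<mu> j)\<^sup>2 \<le> c\<^sup>2 * C\<^sup>2" for j
  proof -
    have "0 \<le> c * \<mu> j" "c * \<mu> j \<le> c * C"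
      using rate mu_ge_1[of j] mu_le[of j] by (auto simp: c_def)
    moreover have "c * C \<le> 1" using rate by (simp add: c_def)
    ultimately show "\<bar>c * \<mu> j\<bar> \<le> 1" by linarith
    show "(c * \<mu> j)\<^sup>2 \<le> c\<^sup>2 * C\<^sup>2"
      using \<open>0 \<le> c * \<mu> j\<close> \<open>c * \<mu> j \<le> c * C\<close>
      by (metis power_mono power_mult_distrib)
  qed
  have "exp (- (c * \<mu> n)) \<le> 1 - c * \<mu> n + c\<^sup>2 * C\<^sup>2"
    using exp_le_quadratic[of "- (c * \<mu> n)"] small[of n] by simp
  moreover have "exp (c * \<mu> (n - 1)) \<le> 1 + c * \<mu> (n - 1) + c\<^sup>2 * C\<^sup>2"
    using exp_le_quadratic[of "c * \<mu> (n - 1)"] small[of "n - 1"] by simp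
  ultimately have "a n * exp (- (c * \<mu> n)) + (1 - a n) * exp (c * \<mu> (n - 1))
    \<le> a n * (1 - c * \<mu> n + c\<^sup>2 * C\<^sup>2) + (1 - a n) * (1 + c * \<mu> (n - 1) + c\<^sup>2 * C\<^sup>2)"
    using a_pos[of n] a_less_1[of n] by (intro add_mono mult_left_mono) auto
  also have "\<dots> = 1 - c * (a n * \<mu> n - (1 - a n) * \<mu> (n - 1)) + c\<^sup>2 * C\<^sup>2" by (simp add: algebra_simps)
  \<comment> \<open>\<open>rate\<close> is the minimizer of \<open>1 - c + c^2 * C^2\<close>, and
    \<open>decay\<close> is the minimum.\<close>
  also have "\<dots> = decay" unfolding mu_eq
    using C_ge_1 by (simp add: c_def rate_def decay_def field_simps eval_nat_numeral)
  finally have *: "a n * exp (- (c * \<mu> n)) + (1 - a n) * exp (c * \<mu> (n - 1)) \<le> decay" .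
  have "weight m (n + 1) = weight m n * exp (- (c * \<mu> n))"
    "weight m (n - 1) = weight m n * exp (c * \<mu> (n - 1))"
    unfolding weight_def c_def isum_Suc isum_pred exp_add[symmetric] by (simp_all add: algebra_simps)
  then have "a n * weight m (n + 1) + (1 - a n) * weight m (n - 1)
     = weight m n * (a n * exp (- (c * \<mu> n)) + (1 - a n) * exp (c * \<mu> (n - 1)))"
    by (simp add: algebra_simps)
  also have "\<dots> \<le> weight m n * decay" using * by (intro mult_left_mono) (auto simp: weight_def)
  finally show ?thesis by (simp add: mult.commute)
qed

text \<open>Discarding the paths that hit \<open>m\<close> only decreases the expectation, and on
  the others \<open>weight_step\<close> contracts.\<close>

lemma E_weight:
  "E z t (\<lambda>l. if m \<in> set l then 0 else weight m (hd l)) \<le> decay ^ t * weight m z"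
proof (induction t)
  case 0
  show ?case by (simp add: weight_def)
next
  case (Suc t)
  have "E z (Suc t) (\<lambda>l. if m \<in> set l then 0 else weight m (hd l))
     \<le> E z t (\<lambda>l. decay * (if m \<in> set l then 0 else weight m (hd l)))"
    unfolding E_Suc
  proof (rule E_mono)
    fix l :: "int list"
    define V where "V v = (if m \<in> set (v # l) then 0 else weight m (hd (v # l)))" for v
    have V: "V v \<le> (if m \<in> set l then 0 else weight m v)" for v by (auto simp: V_def)
    have "a (hd l) *\<^sub>R V (hd l + 1) + (1 - a (hd l)) *\<^sub>R V (hd l - 1)
      \<le> a (hd l) * (if m \<in> set l then 0 else weight m (hd l + 1))
        + (1 - a (hd l)) * (if m \<in> set l then 0 else weight m (hd l - 1))"
      unfolding real_scaleR_def using a_pos[of "hd l"] a_less_1[of "hd l"]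
      by (intro add_mono mult_left_mono V) auto
    also have "\<dots> \<le> decay * (if m \<in> set l then 0 else weight m (hd l))"
      using weight_step[of "hd l" m] by simp
    finally show "a (hd l) *\<^sub>R (if m \<in> set ((hd l + 1) # l) then 0 else weight m (hd ((hd l + 1) # l)))
      + (1 - a (hd l)) *\<^sub>R (if m \<in> set ((hd l - 1) # l) then 0 else weight m (hd ((hd l - 1) # l)))
      \<le> decay * (if m \<in> set l then 0 else weight m (hd l))" unfolding V_def .
  qed
  also have "\<dots> = decay * E z t (\<lambda>l. if m \<in> set l then 0 else weight m (hd l))"
    by (rule integral_mult_right_zero)
  also have "\<dots> \<le> decay * (decay ^ t * weight m z)" using Suc decay by (intro mult_left_mono)
  finally show ?case by simp
qed

lemma decay_limit: "(\<lambda>N. K * (real N + 1)\<^sup>2 * decay ^ N) \<longlonglongrightarrow> 0"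
proof -
  \<comment> \<open>The square root splits the decay evenly, so that the quadratic factor becomes
    the square of a linear one.\<close>
  define r where "r = sqrt decay"
  have r: "norm r < 1" "r\<^sup>2 = decay" using decay by (auto simp: r_def)
  have "(\<lambda>N. real N * r ^ N + r ^ N) \<longlonglongrightarrow> 0 + 0"
    using r(1) by (intro tendsto_add powser_times_n_limit_0 LIMSEQ_power_zero)
  then have "(\<lambda>N. K * (real N * r ^ N + r ^ N)\<^sup>2) \<longlonglongrightarrow> K * (0 + 0)\<^sup>2"
    by (intro tendsto_mult tendsto_power tendsto_const)
  moreover have "K * (real N * r ^ N + r ^ N)\<^sup>2 = K * (real N + 1)\<^sup>2 * decay ^ N" for N
  proof -
    have "real N * r ^ N + r ^ N = (real N + 1) * r ^ N" by (simp add: algebra_simps)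
    moreover have "(r ^ N)\<^sup>2 = decay ^ N" by (simp add: r(2)[symmetric] power_mult[symmetric] mult.commute)
    ultimately show ?thesis by (simp add: power_mult_distrib)
  qed
  ultimately show ?thesis by simp
qed

lemma path_below:
  assumes "l \<in> set_pmf (path_pmf a k t)" "k + 1 \<notin> set l" shows "hd l \<le> k"
  using assms
proof (induction t arbitrary: l)
  case (Suc t)
  then obtain l' v where l: "l' \<in> set_pmf (path_pmf a k t)" "v \<in> set_pmf (walk_step a (hd l'))"
    "l = v # l'" by auto
  with Suc.IH[OF l(1)] Suc.prems(2) set_walk_step[of a "hd l'"] show ?case by auto
qed auto

text \<open>Optional stopping at a bounded time: \<open>harm\<close> makes \<open>f\<close> a
  space-time martingale, and freezing it at the first visit to \<open>m\<close> preserves the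
  mean.\<close>

lemma E_stop:
  assumes harm: "\<And>s n. a n * f (Suc s) (n + 1) + (1 - a n) * f (Suc s) (n - 1) = f s n"
  shows "E z t (stop f m) = f 0 z"
proof (induction t)
  case (Suc t)
  have "E z (Suc t) (stop f m) = E z t (stop f m)"
    unfolding E_Suc
  proof (rule integral_cong_AE, simp, simp, unfold AE_measure_pmf_iff, intro ballI)
    fix l assume "l \<in> set_pmf (path_pmf a z t)"
    then have "length l = Suc t" by (rule length_path_pmf)
    then obtain v l' where "l = v # l'" by (auto simp: length_Suc_conv)
    then show "a (hd l) *\<^sub>R stop f m ((hd l + 1) # l) + (1 - a (hd l)) *\<^sub>R stop f m ((hd l - 1) # l) = stop f m l"
      using harm[of v "length l'"] by (auto simp: algebra_simps)
  qed
  with Suc show ?case by simp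
qed simp

text \<open>The remainder of \<open>stop_split\<close> lives on paths that stay at or below
  \<open>k\<close>, where \<open>bound\<close> applies; the geometric decay in
  \<open>E_weight\<close> beats the factor quadratic in time.\<close>

lemma E_stop_limit:
  assumes harm: "\<And>s n. a n * f (Suc s) (n + 1) + (1 - a n) * f (Suc s) (n - 1) = f s n"
    and bound: "\<And>s n. n \<le> k \<Longrightarrow> \<bar>f s n\<bar> \<le> K * (real s + 1)\<^sup>2 * weight (k + 1) n"
  shows "(\<lambda>N. E k N (stop (\<lambda>s n. if n = k + 1 then f s (k + 1) else 0) (k + 1))) \<longlonglongrightarrow> f 0 k"
proof -
  define \<phi> where "\<phi> = (\<lambda>s n. if n = k + 1 then f s (k + 1) else 0)"
  have "(\<lambda>N. f 0 k - E k N (stop \<phi> (k + 1))) \<longlonglongrightarrow> 0"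
  proof (rule Lim_null_comparison)
    show "(\<lambda>N. K * weight (k + 1) k * (real N + 1)\<^sup>2 * decay ^ N) \<longlonglongrightarrow> 0" by (rule decay_limit)
    have "norm (f 0 k - E k N (stop \<phi> (k + 1))) \<le> K * weight (k + 1) k * (real N + 1)\<^sup>2 * decay ^ N" for N
    proof -
      \<comment> \<open>The sign of \<open>K\<close> follows from \<open>bound\<close> at
        \<open>n = k\<close>, \<open>s = 0\<close>, because the weight is positive.\<close>
      have "0 \<le> K * 1" using order_trans[OF abs_ge_zero bound[of k 0]] by (simp add: weight_def zero_le_mult_iff)
      then have K: "0 \<le> K" by simp
      define r where "r l = (if k + 1 \<in> set l then 0 else f N (hd l))" for l
      have "E k N (stop f (k + 1)) = E k N (\<lambda>l. stop \<phi> (k + 1) l + r l)"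
      proof (rule integral_cong_AE, simp, simp, unfold AE_measure_pmf_iff, intro ballI)
        fix l assume "l \<in> set_pmf (path_pmf a k N)"
        then have "length l = Suc N" by (rule length_path_pmf)
        moreover from this have "l \<noteq> []" by auto
        ultimately show "stop f (k + 1) l = stop \<phi> (k + 1) l + r l"
          using stop_split[of l f "k + 1"] by (simp add: r_def \<phi>_def)
      qed
      then have "f 0 k - E k N (stop \<phi> (k + 1)) = E k N r"
        unfolding E_stop[of f, OF harm] by (subst (asm) Bochner_Integration.integral_add) auto
      then have "norm (f 0 k - E k N (stop \<phi> (k + 1))) \<le> E k N (\<lambda>l. norm (r l))"
        by (simp only: integral_norm_bound)
      also have "\<dots> \<le> E k N (\<lambda>l. K * (real N + 1)\<^sup>2 * (if k + 1 \<in> set l then 0 else weight (k + 1) (hd l)))"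
        using path_below[of _ k N] bound by (intro E_mono) (auto simp: r_def)
      also have "\<dots> = K * (real N + 1)\<^sup>2 * E k N (\<lambda>l. if k + 1 \<in> set l then 0 else weight (k + 1) (hd l))"
        by (rule integral_mult_right_zero)
      also have "\<dots> \<le> K * (real N + 1)\<^sup>2 * (decay ^ N * weight (k + 1) k)"
        using K by (intro mult_left_mono E_weight) auto
      finally show ?thesis by (simp add: mult_ac)
    qed
    then show "\<forall>\<^sub>F N in sequentially. norm (f 0 k - E k N (stop \<phi> (k + 1)))
       \<le> K * weight (k + 1) k * (real N + 1)\<^sup>2 * decay ^ N" by simp
  qed
  from tendsto_diff[OF tendsto_const[of "f 0 k"] this] show ?thesis by (simp add: \<phi>_def)
qed

text \<open>The weight is at least 1 on the sites up to \<open>k\<close>, so \<open>E_weight\<close>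
  bounds the probability of no hit by time \<open>N\<close> geometrically.\<close>

lemma AE_hit: "AE x in walk_law a k. \<exists>t. x t = k + 1"
proof -
  interpret prob_space "walk_law a k" by (rule prob_space_walk_law)
  define B where "B = {x :: nat \<Rightarrow> int. \<forall>t. x t \<noteq> k + 1}"
  have "Measurable.pred (walk_law a k) (\<lambda>x. \<forall>t. x t \<noteq> k + 1)" by measurable
  then have B: "B \<in> sets (walk_law a k)" by (simp add: pred_def B_def space_PiM)
  have w: "1 \<le> weight (k + 1) n" if "n \<le> k" for n
    using isum_diff_ge[of \<mu>, OF mu_ge_1, of n "k + 1"] that rate by (simp add: weight_def)
  have le: "prob B \<le> weight (k + 1) k * decay ^ N" for N
  proof -
    have "prob B = (\<integral>x. indicator B x \<partial>walk_law a k)" by (simp add: space_PiM)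
    also have "\<dots> \<le> (\<integral>x. (if k + 1 \<in> set (history N x) then 0 else 1) \<partial>walk_law a k)"
    proof (rule integral_mono)
      show "integrable (walk_law a k) (indicat_real B)"
        using B by (intro integrable_real_indicator) (auto simp: emeasure_eq_measure)
      show "integrable (walk_law a k) (\<lambda>x. if k + 1 \<in> set (history N x) then 0 else 1 :: real)"
        by (rule integrable_history)
    qed (auto simp: B_def set_history split: split_indicator)
    also have "\<dots> = E k N (\<lambda>l. if k + 1 \<in> set l then 0 else 1)"
      by (rule integral_history)
    also have "\<dots> \<le> E k N (\<lambda>l. if k + 1 \<in> set l then 0 else weight (k + 1) (hd l))"
      using path_below[of _ k N] by (intro E_mono) (auto intro: w)
    also have "\<dots> \<le> decay ^ N * weight (k + 1) k" by (rule E_weight)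
    finally show ?thesis by (simp add: mult.commute)
  qed
  have "(\<lambda>N. weight (k + 1) k * decay ^ N) \<longlonglongrightarrow> weight (k + 1) k * 0"
    using decay by (intro tendsto_mult tendsto_const LIMSEQ_power_zero) auto
  then have "prob B \<le> 0" using le by (intro LIMSEQ_le_const) auto
  then have "prob B = 0" by (simp add: measure_le_0_iff)
  then have "AE x in walk_law a k. x \<notin> B" using B by (simp add: prob_eq_0)
  then show ?thesis by (auto simp: B_def)
qed

text \<open>Monotone convergence in the time horizon, which yields integrability as well. On paths
  that never hit, \<open>LEAST\<close> is unspecified; they form a null set by
  \<open>AE_hit\<close>.\<close>

lemma integral_hitting:
  assumes harm: "\<And>s n. a n * f (Suc s) (n + 1) + (1 - a n) * f (Suc s) (n - 1) = f s n"
    and bound: "\<And>s n. n \<le> k \<Longrightarrow> \<bar>f s n\<bar> \<le> K * (real s + 1)\<^sup>2 * weight (k + 1) n"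
    and nonneg: "\<And>s. 0 \<le> f s (k + 1)"
  shows "(\<integral>x. f (LEAST t. x t = k + 1) (k + 1) \<partial>walk_law a k) = f 0 k"
proof (rule integral_monotone_convergence)
  define \<phi> where "\<phi> s n = (if n = k + 1 then f s (k + 1) else 0)" for s n
  show "integrable (walk_law a k) (\<lambda>x. stop \<phi> (k + 1) (history N x))" for N
    by (rule integrable_history)
  show "AE x in walk_law a k. mono (\<lambda>N. stop \<phi> (k + 1) (history N x))"
    unfolding mono_iff_le_Suc using nonneg
    by (intro AE_I2 allI stop_mono) (auto simp: \<phi>_def)
  show "AE x in walk_law a k. (\<lambda>N. stop \<phi> (k + 1) (history N x)) \<longlonglongrightarrow> f (LEAST t. x t = k + 1) (k + 1)"
    using AE_hit
  proof eventually_elim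
    case (elim x)
    define t where "t = (LEAST t. x t = k + 1)"
    have "x t = k + 1" unfolding t_def using elim by (rule LeastI_ex)
    moreover have "x i \<noteq> k + 1" if "i < t" for i using that not_less_Least unfolding t_def by blast
    ultimately have "stop \<phi> (k + 1) (history N x) = f t (k + 1)" if "t \<le> N" for N
      using stop_history[of x t "k + 1" N \<phi>] that by (simp add: \<phi>_def)
    then show ?case unfolding t_def[symmetric]
      by (intro tendsto_eventually) (auto simp: eventually_sequentially)
  qed
  show "(\<lambda>N. \<integral>x. stop \<phi> (k + 1) (history N x) \<partial>walk_law a k) \<longlonglongrightarrow> f 0 k"
    unfolding integral_history \<phi>_def by (rule E_stop_limit[OF harm bound])
qed measurable

section \<open>Moments of the hitting times\<close>

lemma polynomial_le_weight:
  assumes "n \<le> k"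
  shows "(real s + 1)\<^sup>2 * (H (k + 1) - H n + C)\<^sup>2
     \<le> 2 / rate\<^sup>2 * exp (rate * C) * (real s + 1)\<^sup>2 * weight (k + 1) n"
proof -
  define y where "y = H (k + 1) - H n + C"
  have "0 \<le> y"
    using isum_diff_ge[of \<mu>, OF mu_ge_1, of n "k + 1"] assms C_ge_1 by (simp add: y_def)
  then have "0 \<le> rate * y" using rate by simp
  then have "(rate * y)\<^sup>2 / 2 \<le> exp (rate * y)"
    using exp_lower_Taylor_quadratic[of "rate * y"] by linarith
  also have "exp (rate * y) = exp (rate * C) * weight (k + 1) n"
    by (simp add: weight_def y_def algebra_simps flip: exp_add)
  finally have "y\<^sup>2 \<le> 2 / rate\<^sup>2 * exp (rate * C) * weight (k + 1) n"
    using rate by (simp add: field_simps power_mult_distrib)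
  then have "(real s + 1)\<^sup>2 * y\<^sup>2 \<le> (real s + 1)\<^sup>2 * (2 / rate\<^sup>2 * exp (rate * C) * weight (k + 1) n)"
    by (intro mult_left_mono) auto
  then show ?thesis unfolding y_def by (simp add: mult_ac)
qed

lemma integral_hitting_quadratic:
  assumes harm: "\<And>s n. a n * f (Suc s) (n + 1) + (1 - a n) * f (Suc s) (n - 1) = f s n"
    and bound: "\<And>s n. n \<le> k \<Longrightarrow> \<bar>f s n\<bar> \<le> L * ((real s + 1)\<^sup>2 * (H (k + 1) - H n + C)\<^sup>2)"
    and L: "0 \<le> L"
    and nonneg: "\<And>s. 0 \<le> f s (k + 1)"
  shows "(\<integral>x. f (LEAST t. x t = k + 1) (k + 1) \<partial>walk_law a k) = f 0 k"
proof (rule integral_hitting[where f = f and k = k, OF harm _ nonneg])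
  fix s n assume n: "n \<le> k"
  have "L * ((real s + 1)\<^sup>2 * (H (k + 1) - H n + C)\<^sup>2)
    \<le> L * (2 / rate\<^sup>2 * exp (rate * C) * (real s + 1)\<^sup>2 * weight (k + 1) n)"
    using L polynomial_le_weight[OF n] by (intro mult_left_mono)
  with bound[OF n, of s]
  show "\<bar>f s n\<bar> \<le> L * (2 / rate\<^sup>2 * exp (rate * C)) * (real s + 1)\<^sup>2 * weight (k + 1) n"
    by (simp add: mult_ac)
qed

text \<open>Up to sign and a constant, \<open>f\<close> is the martingale
  \<open>H(X(t)) - t\<close>, normalized to equal the time at the target; its initial value is the
  last increment of \<open>H\<close>.\<close>

lemma hitting_mean: "(\<integral>x. real (LEAST t. x t = k + 1) \<partial>walk_law a k) = \<mu> k"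
proof -
  define f where "f s n = real s + (H (k + 1) - H n)" for s n
  have "(\<integral>x. f (LEAST t. x t = k + 1) (k + 1) \<partial>walk_law a k) = f 0 k"
  proof (rule integral_hitting_quadratic[where L = 1])
    show "a n * f (Suc s) (n + 1) + (1 - a n) * f (Suc s) (n - 1) = f s n" for s n
      using mu_eq[of n] by (simp add: f_def isum_Suc isum_pred) (simp add: algebra_simps)
    show "\<bar>f s n\<bar> \<le> 1 * ((real s + 1)\<^sup>2 * (H (k + 1) - H n + C)\<^sup>2)" if "n \<le> k" for s n
    proof -
      define y where "y = H (k + 1) - H n"
      have y: "0 \<le> y" using isum_diff_ge[of \<mu>, OF mu_ge_1, of n "k + 1"] that by (simp add: y_def)
      have "real s * 1 \<le> real s * C" using C_ge_1 by (intro mult_left_mono) auto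
      moreover have "0 \<le> real s * y" using y by simp
      ultimately have "real s + y \<le> (real s + 1) * (y + C)" using C_ge_1 by (simp add: algebra_simps)
      moreover have "1 * 1 \<le> (real s + 1) * (y + C)" using y C_ge_1 by (intro mult_mono) auto
      then have "(real s + 1) * (y + C) \<le> ((real s + 1) * (y + C))\<^sup>2" by (simp add: self_le_power)
      ultimately show ?thesis using y by (simp add: f_def y_def[symmetric] power_mult_distrib)
    qed
    show "0 \<le> f s (k + 1)" for s by (simp add: f_def)
  qed simp
  then show ?thesis by (simp add: f_def isum_Suc)
qed

text \<open>\<open>f\<close> is the compensated square of the martingale. The constant
  \<open>\<mu> k\<close> makes the square vanish at the start and equal the centered square of the
  time at the target, so that only the increment \<open>g k\<close> of \<open>G\<close>
  remains.\<close>

lemma hitting_variance: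
  "(\<integral>x. (real (LEAST t. x t = k + 1) - \<mu> k)\<^sup>2 \<partial>walk_law a k) = g k"
proof -
  define f where "f s n = (H n - H (k + 1) - real s + \<mu> k)\<^sup>2 + (G (k + 1) - G n)" for s n
  have "(\<integral>x. f (LEAST t. x t = k + 1) (k + 1) \<partial>walk_law a k) = f 0 k"
  proof (rule integral_hitting_quadratic[where L = 2])
    show "a n * f (Suc s) (n + 1) + (1 - a n) * f (Suc s) (n - 1) = f s n" for s n
      using second_moment_step[of n "H n - H (k + 1) - real s + \<mu> k"]
      by (simp add: f_def isum_Suc isum_pred) (simp add: algebra_simps)
    show "\<bar>f s n\<bar> \<le> 2 * ((real s + 1)\<^sup>2 * (H (k + 1) - H n + C)\<^sup>2)" if "n \<le> k" for s n
    proof -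
      define y where "y = H (k + 1) - H n"
      have y: "real_of_int (k + 1 - n) \<le> y"
        using isum_diff_ge[of \<mu>, OF mu_ge_1, of n "k + 1"] that by (simp add: y_def)
      then have y0: "0 \<le> y" using that by simp
      have "\<bar>G (k + 1) - G n\<bar> \<le> C * \<bar>real_of_int (k + 1 - n)\<bar>"
        using isum_diff_le[of g C "k + 1" n] g_nonneg g_le by simp
      also have "\<dots> \<le> C * y" using y that C_ge_1 by (intro mult_left_mono) auto
      also have "\<dots> \<le> 1 * (y + C)\<^sup>2" using y0 C_ge_1 by (simp add: power2_eq_square algebra_simps)
      also have "\<dots> \<le> (real s + 1)\<^sup>2 * (y + C)\<^sup>2" by (intro mult_right_mono) auto
      finally have 1: "\<bar>G (k + 1) - G n\<bar> \<le> (real s + 1)\<^sup>2 * (y + C)\<^sup>2" .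
      have "real s * 1 \<le> real s * C" using C_ge_1 by (intro mult_left_mono) auto
      moreover have "0 \<le> real s * y" using y0 by simp
      ultimately have "y + real s + C \<le> (real s + 1) * (y + C)" by (simp add: algebra_simps)
      moreover have "\<bar>- y - real s + \<mu> k\<bar> \<le> y + real s + C"
        using mu_ge_1[of k] mu_le[of k] y0 by linarith
      ultimately have "\<bar>- y - real s + \<mu> k\<bar> \<le> (real s + 1) * (y + C)" by linarith
      then have "(- y - real s + \<mu> k)\<^sup>2 \<le> ((real s + 1) * (y + C))\<^sup>2"
        by (rule power2_le_iff_abs_le[THEN iffD2, rotated]) (use y0 C_ge_1 in simp)
      then have "(H n - H (k + 1) - real s + \<mu> k)\<^sup>2 \<le> (real s + 1)\<^sup>2 * (y + C)\<^sup>2"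
        by (simp add: y_def power_mult_distrib)
      moreover have "0 \<le> (H n - H (k + 1) - real s + \<mu> k)\<^sup>2" by simp
      ultimately show ?thesis using 1 unfolding f_def y_def[symmetric] by linarith
    qed
    show "0 \<le> f s (k + 1)" for s by (simp add: f_def)
  qed simp
  then show ?thesis by (simp add: f_def isum_Suc power2_commute)
qed

lemma var_tau_eq: "var_tau a k = g k"
proof -
  define \<tau> where "\<tau> x = real_of_ereal (ereal_of_enat (hitting_time (k + 1) x))" for x
  have \<tau>: "\<tau> x = (if \<exists>t. x t = k + 1 then real (LEAST t. x t = k + 1) else 0)" for x
    by (simp add: \<tau>_def hitting_time_eq)
  have [measurable]: "\<tau> \<in> borel_measurable (walk_law a k)"
    unfolding \<tau>[abs_def] by measurable
  have AE: "AE x in walk_law a k. \<tau> x = real (LEAST t. x t = k + 1)"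
    using AE_hit by eventually_elim (simp add: \<tau>)
  have mean: "(\<integral>x. \<tau> x \<partial>walk_law a k) = \<mu> k"
    unfolding hitting_mean[symmetric] using AE by (intro integral_cong_AE) measurable
  have "(\<integral>x. (\<tau> x - \<mu> k)\<^sup>2 \<partial>walk_law a k) = g k"
    unfolding hitting_variance[symmetric] using AE by (intro integral_cong_AE) (measurable, auto)
  then show ?thesis unfolding var_tau_def mean[unfolded \<tau>_def] \<tau>_def .
qed

end

section \<open>Uniformly ergodic environments\<close>

lemma isum_of_nat: "isum d (int n) = (\<Sum>k<n. d (int k))"
proof (induction n)
  case (Suc n)
  have "isum d (int (Suc n)) = isum d (int n + 1)" by (simp add: algebra_simps)
  then show ?case unfolding isum_Suc Suc by simp
qed simp

lemma sum_of_nat_Suc_eq: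
  fixes d :: "int \<Rightarrow> real"
  assumes "i \<le> j"
  shows "(\<Sum>k\<in>{i..<j}. d k) = (\<Sum>l=1..nat (j - i). d (int l + (i - 1)))"
  by (rule sum.reindex_bij_witness[of _ "\<lambda>l. int l + (i - 1)" "\<lambda>k. nat (k - i + 1)"]) (use assms in auto)

section \<open>Covariance of the environment under the shift\<close>

context random_environment
begin

abbreviation "Tinv \<equiv> inv_into (space M) T"
abbreviation "A \<equiv> env_A M T p"
abbreviation "P \<equiv> env_p M T p"
abbreviation "mu \<equiv> env_mu M T p"

lemma Tinv_space: "\<omega> \<in> space M \<Longrightarrow> Tinv \<omega> \<in> space M"
  using bij_T by (auto simp: bij_betw_def intro: inv_into_into)

lemma T_Tinv: "\<omega> \<in> space M \<Longrightarrow> T (Tinv \<omega>) = \<omega>"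
  using bij_T by (auto simp: bij_betw_def f_inv_into_f)

lemma measurable_iterate [measurable]: "iterate M T n \<in> M \<rightarrow>\<^sub>M M"
proof -
  have "(f ^^ k) \<in> M \<rightarrow>\<^sub>M M" if "f \<in> M \<rightarrow>\<^sub>M M" for f k
    using that by (induction k) (auto simp: comp_def intro: measurable_compose)
  then show ?thesis using measurable_T measurable_inv_T by (auto simp: iterate_def)
qed

lemma iterate_space: "\<omega> \<in> space M \<Longrightarrow> iterate M T n \<omega> \<in> space M"
  using measurable_space[OF measurable_iterate] .

lemma iterate_0 [simp]: "iterate M T 0 \<omega> = \<omega>"
  by (simp add: iterate_def)

lemma iterate_Suc:
  assumes "\<omega> \<in> space M" shows "iterate M T (n + 1) \<omega> = T (iterate M T n \<omega>)"
proof (cases "0 \<le> n")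
  case True
  then have "nat (n + 1) = Suc (nat n)" by simp
  with True show ?thesis by (simp add: iterate_def)
next
  case False
  define j where "j = nat (- n - 1)"
  have j: "nat (- n) = Suc j" "n + 1 = - int j" using False by (auto simp: j_def)
  have "(Tinv ^^ j) \<omega> \<in> space M" using assms Tinv_space by (induction j) auto
  then have "T (iterate M T n \<omega>) = (Tinv ^^ j) \<omega>" using False by (simp add: iterate_def j(1) T_Tinv)
  also have "\<dots> = iterate M T (n + 1) \<omega>" unfolding j(2) by (cases "j = 0") (simp_all add: iterate_def)
  finally show ?thesis by simp
qed

lemma T_inj: "\<omega> \<in> space M \<Longrightarrow> \<omega>' \<in> space M \<Longrightarrow> T \<omega> = T \<omega>' \<Longrightarrow> \<omega> = \<omega>'"
  using bij_T by (auto simp: bij_betw_def inj_on_def)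

lemma iterate_add:
  assumes "\<omega> \<in> space M" shows "iterate M T (n + k) \<omega> = iterate M T n (iterate M T k \<omega>)"
proof (induction n rule: int_induct[of _ 0])
  case (step1 n)
  have eq: "n + 1 + k = (n + k) + 1" by simp
  show ?case
    by (simp only: eq iterate_Suc[OF assms] iterate_Suc[OF iterate_space[OF assms]] step1(2))
next
  case (step2 n)
  have eq: "n - 1 + k + 1 = n + k" "n - 1 + 1 = n" by simp_all
  \<comment> \<open>In the downward direction the two sides are compared after one application of
    \<open>T\<close>, which is injective on the space.\<close>
  have "T (iterate M T (n - 1 + k) \<omega>) = T (iterate M T (n - 1) (iterate M T k \<omega>))"
    using iterate_Suc[OF assms, of "n - 1 + k"] iterate_Suc[OF iterate_space[OF assms], of "n - 1" k]
    by (simp only: eq step2(2))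
  then show ?case by (rule T_inj[rotated 2]) (intro iterate_space assms)+
qed simp

lemma iterate_of_nat: "iterate M T (int n) \<omega> = (T ^^ n) \<omega>"
  by (simp add: iterate_def)

lemma P_shift: "\<omega> \<in> space M \<Longrightarrow> P \<omega> (n + k) = P (iterate M T k \<omega>) n"
  by (simp add: env_p_def iterate_add)

lemma A_shift: "\<omega> \<in> space M \<Longrightarrow> A \<omega> (n + k) = A (iterate M T k \<omega>) n"
  by (simp add: env_A_def P_shift)

lemma mu_term_shift:
  assumes "\<omega> \<in> space M"
  shows "mu_term M T p \<omega> (n + k) j = mu_term M T p (iterate M T k \<omega>) n j"
  unfolding mu_term_def
  by (rule prod.reindex_bij_witness[of _ "\<lambda>i. i + k" "\<lambda>i. i - k"])
    (auto simp flip: A_shift[OF assms])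

lemma mu_shift: "\<omega> \<in> space M \<Longrightarrow> mu \<omega> (n + k) = mu (iterate M T k \<omega>) n"
  by (simp add: env_mu_def mu_term_shift)

lemma P_bounds: "\<omega> \<in> space M \<Longrightarrow> 0 < P \<omega> n" "\<omega> \<in> space M \<Longrightarrow> P \<omega> n < 1"
  using p_range[OF iterate_space, of \<omega> n] by (auto simp: env_p_def)

lemma A_pos: "\<omega> \<in> space M \<Longrightarrow> 0 < A \<omega> n"
  using P_bounds[of \<omega> n] by (simp add: env_A_def)

lemma P_A: "\<omega> \<in> space M \<Longrightarrow> P \<omega> n * A \<omega> n = 1 - P \<omega> n"
  using P_bounds[of \<omega> n] by (simp add: env_A_def)

lemma mu_term_pos: "\<omega> \<in> space M \<Longrightarrow> 0 < mu_term M T p \<omega> k j"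
  using A_pos by (simp add: mu_term_def prod_pos)

lemma mu_term_0: "mu_term M T p \<omega> k 0 = A \<omega> k"
  by (simp add: mu_term_def)

lemma mu_term_Suc: "mu_term M T p \<omega> k (Suc j) = A \<omega> k * mu_term M T p \<omega> (k - 1) j"
proof -
  have "{k - int (Suc j)..k} = insert k {k - 1 - int j..k - 1}" by auto
  then show ?thesis by (simp add: mu_term_def)
qed

lemma measurable_P [measurable]: "(\<lambda>\<omega>. P \<omega> n) \<in> borel_measurable M"
  unfolding env_p_def using measurable_p by measurable

lemma measurable_A [measurable]: "(\<lambda>\<omega>. A \<omega> n) \<in> borel_measurable M"
  unfolding env_A_def by measurable

lemma measurable_mu_term [measurable]: "(\<lambda>\<omega>. mu_term M T p \<omega> k j) \<in> borel_measurable M"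
  unfolding mu_term_def by measurable

lemma measurable_mu [measurable]: "(\<lambda>\<omega>. mu \<omega> k) \<in> borel_measurable M"
  unfolding env_mu_def by measurable

text \<open>The step variance divided by \<open>P\<close>: with this normalization the equation for
  \<open>g\<close> reads \<open>g k = drift_var k + A k * g (k - 1)\<close> and can be iterated
  backwards.\<close>

definition drift_var :: "'w \<Rightarrow> int \<Rightarrow> real" where
  "drift_var \<omega> n = (P \<omega> n * (mu \<omega> n)\<^sup>2 + (1 - P \<omega> n) * (mu \<omega> (n - 1))\<^sup>2 - 1) / P \<omega> n"

text \<open>The solution of \<open>p\<^sub>k g\<^sub>k - q\<^sub>k g\<^sub>k\<^sub>-\<^sub>1 = v\<^sub>k\<close>, where \<open>v\<^sub>k\<close> is the variance of a step of
  the martingale \<open>H(X(t)) - t\<close> from \<open>k\<close>; it turns out to be the variance of \<open>\<tau>\<^sub>k\<close>.\<close>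

definition var_series :: "'w \<Rightarrow> int \<Rightarrow> real" where
  "var_series \<omega> k = drift_var \<omega> k + (\<Sum>j. mu_term M T p \<omega> k j * drift_var \<omega> (k - 1 - int j))"

lemma drift_var_shift: "\<omega> \<in> space M \<Longrightarrow> drift_var \<omega> (n + k) = drift_var (iterate M T k \<omega>) n"
  using P_shift[of \<omega> n k] mu_shift[of \<omega> n k] mu_shift[of \<omega> "n - 1" k]
  by (simp add: drift_var_def algebra_simps)

lemma var_series_shift:
  assumes "\<omega> \<in> space M" shows "var_series \<omega> (n + k) = var_series (iterate M T k \<omega>) n"
proof -
  have "drift_var \<omega> (n + k - 1 - int j) = drift_var (iterate M T k \<omega>) (n - 1 - int j)" for j
    using drift_var_shift[OF assms, of "n - 1 - int j" k] by (simp add: algebra_simps)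
  then show ?thesis by (simp add: var_series_def drift_var_shift mu_term_shift assms)
qed

lemma measurable_var_series [measurable]: "(\<lambda>\<omega>. var_series \<omega> k) \<in> borel_measurable M"
  unfolding var_series_def drift_var_def by measurable

end

section \<open>Bounds in environments with bounded \<open>mu\<close>\<close>

locale bounded_environment = random_environment +
  fixes B :: real
  assumes summable_mu: "\<omega> \<in> space M \<Longrightarrow> summable (mu_term M T p \<omega> 0)"
    and mu_bounded: "\<omega> \<in> space M \<Longrightarrow> mu \<omega> 0 \<le> B"
begin

lemma summable_mu_term: "\<omega> \<in> space M \<Longrightarrow> summable (mu_term M T p \<omega> k)"
  using summable_mu[OF iterate_space, of \<omega> k] mu_term_shift[of \<omega> 0 k] by (simp add: summable_def sums_def)

lemma mu_le_B: "\<omega> \<in> space M \<Longrightarrow> mu \<omega> k \<le> B"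
  using mu_bounded[OF iterate_space, of \<omega> k] mu_shift[of \<omega> 0 k] by simp

lemma mu_rec:
  assumes "\<omega> \<in> space M" shows "mu \<omega> k = 1 + A \<omega> k * (1 + mu \<omega> (k - 1))"
proof -
  have "(\<Sum>j. mu_term M T p \<omega> k j) = A \<omega> k + (\<Sum>j. A \<omega> k * mu_term M T p \<omega> (k - 1) j)"
    using suminf_split_head[OF summable_mu_term[OF assms, of k]] by (simp add: mu_term_0 mu_term_Suc)
  also have "(\<Sum>j. A \<omega> k * mu_term M T p \<omega> (k - 1) j) = A \<omega> k * (\<Sum>j. mu_term M T p \<omega> (k - 1) j)"
    by (rule suminf_mult[OF summable_mu_term[OF assms]])
  finally show ?thesis by (simp add: env_mu_def algebra_simps)
qed

lemma suminf_mu_term_nonneg: "\<omega> \<in> space M \<Longrightarrow> 0 \<le> (\<Sum>j. mu_term M T p \<omega> k j)"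
  using mu_term_pos by (intro suminf_nonneg summable_mu_term less_imp_le) auto

lemma mu_ge: "\<omega> \<in> space M \<Longrightarrow> 1 \<le> mu \<omega> k"
  using suminf_mu_term_nonneg[of \<omega> k] by (simp add: env_mu_def)

lemma B_ge_1: "1 \<le> B"
proof -
  obtain \<omega> where "\<omega> \<in> space M" using not_empty by blast
  then show ?thesis using mu_ge[of \<omega> 0] mu_bounded[of \<omega>] by simp
qed

lemma P_mu: "\<omega> \<in> space M \<Longrightarrow> P \<omega> k * mu \<omega> k - (1 - P \<omega> k) * mu \<omega> (k - 1) = 1"
proof -
  assume w: "\<omega> \<in> space M"
  have "P \<omega> k * mu \<omega> k = P \<omega> k + (P \<omega> k * A \<omega> k) * (1 + mu \<omega> (k - 1))"
    by (subst mu_rec[OF w]) (simp add: algebra_simps)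
  then show ?thesis unfolding P_A[OF w] by (simp add: algebra_simps)
qed

text \<open>\<open>P_mu\<close> forces \<open>P * mu \<ge> 1\<close>, so a bound on
  \<open>mu\<close> keeps the jumps to the right uniformly likely.\<close>

lemma P_ge: assumes w: "\<omega> \<in> space M" shows "1 / B \<le> P \<omega> k"
proof -
  have "1 \<le> P \<omega> k * mu \<omega> k"
    using P_mu[OF w, of k] P_bounds[OF w, of k] mu_ge[OF w, of "k - 1"] by (smt (verit) mult_nonneg_nonneg)
  also have "\<dots> \<le> P \<omega> k * B" using mu_le_B[OF w] P_bounds[OF w] by (intro mult_left_mono) (auto intro: less_imp_le)
  finally show ?thesis using B_ge_1 by (simp add: field_simps)
qed

text \<open>Written as a mean of squared increments, the step variance is positive because a jump to
  the left changes \<open>H - t\<close> by at least 2 in absolute value.\<close>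

lemma drift_var_pos: assumes w: "\<omega> \<in> space M" shows "0 < drift_var \<omega> k"
proof -
  have "P \<omega> k * (mu \<omega> k)\<^sup>2 + (1 - P \<omega> k) * (mu \<omega> (k - 1))\<^sup>2 - 1
     = P \<omega> k * (mu \<omega> k - 1)\<^sup>2 + (1 - P \<omega> k) * (mu \<omega> (k - 1) + 1)\<^sup>2"
    using P_mu[OF w, of k] by algebra
  also have "\<dots> > 0"
    using P_bounds[OF w, of k] mu_ge[OF w, of "k - 1"] by (intro add_nonneg_pos mult_pos_pos) auto
  finally show ?thesis using P_bounds[OF w, of k] by (simp add: drift_var_def)
qed

lemma drift_var_le: assumes w: "\<omega> \<in> space M" shows "drift_var \<omega> k \<le> B ^ 3"
proof -
  have "P \<omega> k * (mu \<omega> k)\<^sup>2 + (1 - P \<omega> k) * (mu \<omega> (k - 1))\<^sup>2 \<le> P \<omega> k * B\<^sup>2 + (1 - P \<omega> k) * B\<^sup>2"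
    using P_bounds[OF w, of k] mu_ge[OF w, of k] mu_ge[OF w, of "k - 1"] mu_le_B[OF w, of k] mu_le_B[OF w, of "k - 1"]
    by (intro add_mono mult_left_mono power_mono) auto
  then have v: "P \<omega> k * (mu \<omega> k)\<^sup>2 + (1 - P \<omega> k) * (mu \<omega> (k - 1))\<^sup>2 - 1 \<le> B\<^sup>2" by (simp add: algebra_simps)
  have "1 / P \<omega> k \<le> B" using P_ge[OF w, of k] P_bounds[OF w, of k] B_ge_1 by (simp add: field_simps)
  then have "drift_var \<omega> k \<le> B\<^sup>2 * B"
    unfolding drift_var_def divide_inverse
    using v P_bounds[OF w, of k] by (intro mult_mono) (auto simp: divide_inverse)
  then show ?thesis by (simp add: eval_nat_numeral)
qed

lemma summable_var_series:
  assumes w: "\<omega> \<in> space M" shows "summable (\<lambda>j. mu_term M T p \<omega> k j * drift_var \<omega> (l j))"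
proof (rule summable_comparison_test)
  show "summable (\<lambda>j. mu_term M T p \<omega> k j * B ^ 3)" by (intro summable_mult2 summable_mu_term w)
  show "\<exists>N. \<forall>j\<ge>N. norm (mu_term M T p \<omega> k j * drift_var \<omega> (l j)) \<le> mu_term M T p \<omega> k j * B ^ 3"
    using mu_term_pos[OF w, of k] drift_var_pos[OF w] drift_var_le[OF w]
    by (auto simp: abs_mult abs_of_pos intro!: mult_left_mono less_imp_le)
qed

lemma var_series_rec:
  assumes w: "\<omega> \<in> space M" shows "var_series \<omega> k = drift_var \<omega> k + A \<omega> k * var_series \<omega> (k - 1)"
proof -
  define d where "d j = drift_var \<omega> (k - 1 - int j)" for j
  have "(\<Sum>j. mu_term M T p \<omega> k j * d j)
     = mu_term M T p \<omega> k 0 * d 0 + (\<Sum>j. mu_term M T p \<omega> k (Suc j) * d (Suc j))"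
    using suminf_split_head[OF summable_var_series[OF w, of k "\<lambda>j. k - 1 - int j"]] by (simp add: d_def)
  also have "(\<Sum>j. mu_term M T p \<omega> k (Suc j) * d (Suc j))
     = (\<Sum>j. A \<omega> k * (mu_term M T p \<omega> (k - 1) j * drift_var \<omega> (k - 1 - 1 - int j)))"
    by (simp add: mu_term_Suc d_def algebra_simps)
  also have "\<dots> = A \<omega> k * (\<Sum>j. mu_term M T p \<omega> (k - 1) j * drift_var \<omega> (k - 1 - 1 - int j))"
    by (rule suminf_mult[OF summable_var_series[OF w]])
  finally show ?thesis unfolding var_series_def d_def by (simp add: mu_term_0 algebra_simps)
qed

lemma var_series_pos: "\<omega> \<in> space M \<Longrightarrow> 0 < var_series \<omega> k"
  unfolding var_series_def
  by (intro add_pos_nonneg drift_var_pos suminf_nonneg summable_var_series mult_nonneg_nonneg less_imp_le mu_term_pos)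

text \<open>Each \<open>drift_var\<close> is at most \<open>B ^ 3\<close>, and the total weight
  \<open>1 + (\<Sum>j. mu_term M T p \<omega> k j)\<close> is at most \<open>mu\<close>, hence at
  most \<open>B\<close>.\<close>

lemma var_series_le: assumes w: "\<omega> \<in> space M" shows "var_series \<omega> k \<le> B ^ 4"
proof -
  have "(\<Sum>j. mu_term M T p \<omega> k j * drift_var \<omega> (k - 1 - int j)) \<le> (\<Sum>j. mu_term M T p \<omega> k j * B ^ 3)"
    using mu_term_pos[OF w, of k] drift_var_le[OF w]
    by (intro suminf_le summable_var_series summable_mult2 summable_mu_term w mult_left_mono) (auto intro: less_imp_le)
  also have "\<dots> = (\<Sum>j. mu_term M T p \<omega> k j) * B ^ 3"
    by (rule suminf_mult2[symmetric, OF summable_mu_term[OF w]])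
  finally have "var_series \<omega> k \<le> B ^ 3 + (\<Sum>j. mu_term M T p \<omega> k j) * B ^ 3"
    using drift_var_le[OF w, of k] by (simp add: var_series_def)
  also have "\<dots> = (1 + (\<Sum>j. mu_term M T p \<omega> k j)) * B ^ 3" by (simp add: algebra_simps)
  also have "\<dots> \<le> B * B ^ 3"
    using mu_le_B[OF w, of k] suminf_mu_term_nonneg[OF w, of k] B_ge_1
    by (intro mult_right_mono) (auto simp: env_mu_def)
  finally show ?thesis by (simp add: eval_nat_numeral)
qed

lemma drift_walk: assumes w: "\<omega> \<in> space M"
  shows "drift_walk (P \<omega>) (mu \<omega>) (var_series \<omega>) (B ^ 4)"
proof
  fix n
  show "0 < P \<omega> n" "P \<omega> n < 1" "1 \<le> mu \<omega> n" "0 \<le> var_series \<omega> n" "var_series \<omega> n \<le> B ^ 4"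
    "P \<omega> n * mu \<omega> n - (1 - P \<omega> n) * mu \<omega> (n - 1) = 1"
    using P_bounds[OF w] mu_ge[OF w] var_series_pos[OF w, THEN less_imp_le] var_series_le[OF w] P_mu[OF w] by auto
  have "B ^ 1 \<le> B ^ 4" using B_ge_1 by (intro power_increasing) auto
  then show "mu \<omega> n \<le> B ^ 4" using mu_le_B[OF w, of n] by simp
  have "P \<omega> n * var_series \<omega> n = P \<omega> n * drift_var \<omega> n + (P \<omega> n * A \<omega> n) * var_series \<omega> (n - 1)"
    by (subst var_series_rec[OF w]) (simp add: algebra_simps)
  then show "P \<omega> n * var_series \<omega> n - (1 - P \<omega> n) * var_series \<omega> (n - 1)
     = P \<omega> n * (mu \<omega> n)\<^sup>2 + (1 - P \<omega> n) * (mu \<omega> (n - 1))\<^sup>2 - 1"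
    unfolding P_A[OF w] using P_bounds[OF w, of n] by (simp add: drift_var_def)
qed

section \<open>The annealed constants and the implicit centering\<close>

lemma env_sigma2_eq: "env_sigma2 M T p = (\<integral>\<omega>. var_series \<omega> 0 \<partial>M)"
  unfolding env_sigma2_def
  by (intro Bochner_Integration.integral_cong refl drift_walk.var_tau_eq[OF drift_walk])

lemma integrable_var_series: "integrable M (\<lambda>\<omega>. var_series \<omega> 0)"
  using var_series_pos var_series_le
  by (intro integrable_const_bound[where B = "B ^ 4"] AE_I2) (auto simp: abs_of_pos)

lemma integrable_mu: "integrable M (\<lambda>\<omega>. mu \<omega> 0)"
proof (rule integrable_const_bound[where B = B])
  show "AE \<omega> in M. norm (mu \<omega> 0) \<le> B"
    using mu_ge[of _ 0] mu_bounded by (intro AE_I2) fastforce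
qed measurable

lemma env_sigma2_pos: "0 < env_sigma2 M T p"
  unfolding env_sigma2_eq using var_series_pos
  by (intro expectation_greater integrable_var_series AE_I2)

lemma env_mean_mu_ge: "1 \<le> env_mean_mu M T p"
proof -
  have "(\<integral>\<omega>. 1 \<partial>M) \<le> (\<integral>\<omega>. mu \<omega> 0 \<partial>M)"
    using mu_ge by (intro integral_mono integrable_mu) auto
  then show ?thesis by (simp add: env_mean_mu_def prob_space)
qed

lemma env_H_eq: "env_H M T p \<omega> n = isum (mu \<omega>) (int n)"
  by (simp add: env_H_def isum_of_nat)

text \<open>\<open>H\<close> starts at 0 and has increments between 1 and \<open>B\<close>, so
  exactly one index brackets \<open>t\<close> and the gap there is at most \<open>B\<close>.\<close>

lemma b_tilde_close:
  assumes w: "\<omega> \<in> space M"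
  shows "\<bar>isum (mu \<omega>) (int (b_tilde M T p \<omega> t)) - real t\<bar> \<le> B"
proof -
  define h where "h = env_H M T p \<omega>"
  have h0: "h 0 = 0" by (simp add: h_def env_H_def)
  have h_Suc: "h (Suc n) = h n + mu \<omega> (int n)" for n by (simp add: h_def env_H_def)
  have h_mono: "h m \<le> h n" if "m \<le> n" for m n
    using that
  proof (induction n rule: dec_induct)
    case (step n)
    then show ?case using h_Suc[of n] mu_ge[OF w, of "int n"] by linarith
  qed simp
  have h_ge: "real n \<le> h n" for n
  proof (induction n)
    case (Suc n)
    then show ?case using mu_ge[OF w, of "int n"] by (simp add: h_Suc)
  qed (simp add: h0)
  define N where "N = (LEAST n. real t < h (n + 1))"
  have "real t < h (t + 1)" using h_ge[of "t + 1"] by simp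
  then have N1: "real t < h (N + 1)" unfolding N_def by (rule LeastI)
  have N2: "h N \<le> real t"
  proof (cases N)
    case (Suc n)
    then have "\<not> real t < h (n + 1)" using not_less_Least[of n "\<lambda>n. real t < h (n + 1)"] by (simp add: N_def)
    with Suc show ?thesis by simp
  qed (simp add: h0)
  have "b_tilde M T p \<omega> t = N"
    unfolding b_tilde_def h_def[symmetric]
  proof (rule the_equality)
    fix b assume b: "h b \<le> real t \<and> real t < h (b + 1)"
    show "b = N"
    proof (rule ccontr)
      assume "b \<noteq> N"
      then have "b + 1 \<le> N \<or> N + 1 \<le> b" by linarith
      then show False using h_mono[of "b + 1" N] h_mono[of "N + 1" b] b N1 N2 by linarith
    qed
  qed (use N1 N2 in simp)
  moreover have "h (N + 1) \<le> h N + B" using h_Suc[of N] mu_le_B[OF w, of "int N"] by simp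
  ultimately show ?thesis using N1 N2 by (simp add: env_H_eq[symmetric] h_def)
qed

text \<open>Displays the two sources of the scale: the standard deviation of the martingale and the
  slope \<open>mu\<close> of the linearization.\<close>

lemma sigma_star_eq:
  "sigma_star M T p = sqrt (env_sigma2 M T p / env_mean_mu M T p) / env_mean_mu M T p"
proof -
  have "env_sigma2 M T p / env_mean_mu M T p ^ 3
      = env_sigma2 M T p / env_mean_mu M T p / (env_mean_mu M T p)\<^sup>2"
    by (simp add: eval_nat_numeral)
  then show ?thesis
    unfolding sigma_star_def using env_mean_mu_ge by (simp only: real_sqrt_divide) simp
qed

end

section \<open>Uniform ergodicity and the limit theorems\<close>

lemma (in random_environment) bounded_environment_exists:
  assumes unif: "uniformly_ergodic_env M T p"
  obtains B where "bounded_environment M T p B"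
proof -
  from unif obtain \<epsilon> where *: "\<And>\<omega>. \<omega> \<in> space M \<Longrightarrow> summable (mu_term M T p \<omega> 0)"
    "\<And>\<omega> n. \<omega> \<in> space M \<Longrightarrow> n \<ge> 1 \<Longrightarrow>
       \<bar>(\<Sum>j=1..n. mu ((T ^^ j) \<omega>) 0) / real n - (\<integral>\<omega>'. mu \<omega>' 0 \<partial>M)\<bar> \<le> \<epsilon> n"
    unfolding uniformly_ergodic_env_def uniformly_ergodic_for_def by metis
  have "mu \<omega> 0 \<le> (\<integral>\<omega>'. mu \<omega>' 0 \<partial>M) + \<epsilon> 1" if w: "\<omega> \<in> space M" for \<omega>
    using *(2)[OF Tinv_space[OF w], of 1] T_Tinv[OF w] by simp
  then have "bounded_environment M T p ((\<integral>\<omega>'. mu \<omega>' 0 \<partial>M) + \<epsilon> 1)"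
    using *(1) by unfold_locales auto
  then show thesis by (rule that)
qed

text \<open>The errors \<open>\<epsilon>\<close> do not depend on the environment, so the ergodic
  estimate can be started at any shifted environment; one \<open>K\<close> then serves all windows.
  \<open>sublinear_bound\<close> is applied to \<open>n * \<epsilon> n\<close>.\<close>

lemma (in random_environment) uniform_mu_sums:
  assumes unif: "uniformly_ergodic_env M T p" and \<delta>: "\<delta> > 0"
  shows "\<exists>K. \<forall>\<omega>\<in>space M. \<forall>i j. i \<le> j \<longrightarrow>
    \<bar>(\<Sum>k\<in>{i..<j}. mu \<omega> k) - env_mean_mu M T p * real_of_int (j - i)\<bar> \<le> \<delta> * real_of_int (j - i) + K"
proof -
  define m where "m = env_mean_mu M T p"
  from unif obtain \<epsilon> where \<epsilon>: "\<epsilon> \<longlonglongrightarrow> 0" and *: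
    "\<And>\<omega> n. \<omega> \<in> space M \<Longrightarrow> n \<ge> 1 \<Longrightarrow> \<bar>(\<Sum>j=1..n. mu ((T ^^ j) \<omega>) 0) / real n - m\<bar> \<le> \<epsilon> n"
    unfolding uniformly_ergodic_env_def uniformly_ergodic_for_def m_def env_mean_mu_def by blast
  have "(\<lambda>n. real n * \<epsilon> n / real n) \<longlonglongrightarrow> 0"
    by (rule Lim_transform_eventually[OF \<epsilon> eventually_mono[OF eventually_gt_at_top[of 0]]]) simp
  from sublinear_bound[OF this \<delta>] obtain K where K: "K \<ge> 0" "\<And>n. \<bar>real n * \<epsilon> n\<bar> \<le> \<delta> * real n + K" by blast
  have "\<bar>(\<Sum>k\<in>{i..<j}. mu \<omega> k) - m * real_of_int (j - i)\<bar> \<le> \<delta> * real_of_int (j - i) + K"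
    if w: "\<omega> \<in> space M" and ij: "i \<le> j" for \<omega> i j
  proof (cases "i = j")
    case False
    define n where "n = nat (j - i)"
    have n: "n \<ge> 1" "real_of_int (j - i) = real n" using ij False by (auto simp: n_def)
    \<comment> \<open>The ergodic sums begin with the first iterate, so the base point for a window
      starting at \<open>i\<close> is the shift by \<open>i - 1\<close>.\<close>
    define \<omega>' where "\<omega>' = iterate M T (i - 1) \<omega>"
    have w': "\<omega>' \<in> space M" unfolding \<omega>'_def by (rule iterate_space[OF w])
    have "(\<Sum>k\<in>{i..<j}. mu \<omega> k) = (\<Sum>l=1..n. mu \<omega> (int l + (i - 1)))"
      unfolding n_def by (rule sum_of_nat_Suc_eq[OF ij])
    also have "\<dots> = (\<Sum>l=1..n. mu ((T ^^ l) \<omega>') 0)"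
    proof (rule sum.cong)
      fix l
      show "mu \<omega> (int l + (i - 1)) = mu ((T ^^ l) \<omega>') 0"
        unfolding mu_shift[OF w] \<omega>'_def[symmetric] iterate_of_nat[symmetric]
        using mu_shift[OF w', of 0 "int l"] by simp
    qed simp
    finally have "(\<Sum>k\<in>{i..<j}. mu \<omega> k) - m * real_of_int (j - i)
      = real n * ((\<Sum>l=1..n. mu ((T ^^ l) \<omega>') 0) / real n - m)"
      using n by (simp add: field_simps)
    then have "\<bar>(\<Sum>k\<in>{i..<j}. mu \<omega> k) - m * real_of_int (j - i)\<bar> \<le> real n * \<epsilon> n"
      using *[OF w' n(1)] by (simp add: abs_mult mult_left_mono)
    then show ?thesis using K(2)[of n] unfolding n(2) by linarith
  qed (use K in simp)
  then show ?thesis unfolding m_def by blast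
qed

text \<open>The window has length of order \<open>\<bar>s\<bar> * sqrt t\<close>, and the error
  bound for a window does not depend on its location, so \<open>b\<close> may be arbitrary.\<close>

lemma (in bounded_environment) centering_limit:
  assumes unif: "uniformly_ergodic_env M T p" and w: "\<omega> \<in> space M"
  shows "(\<lambda>t::nat. real t powr (- 1 / 2) *
      real_sum (\<lambda>k. mu \<omega> k - env_mean_mu M T p) (real (b t)) (real (b t) + sqrt (real t) * s))
    \<longlonglongrightarrow> 0"
proof -
  define m where "m = env_mean_mu M T p"
  define d where "d k = mu \<omega> k - m" for k
  define S where "S t = real_sum d (real (b t)) (real (b t) + sqrt (real t) * s)" for t :: nat
  have "(\<lambda>t. \<bar>real t powr (- 1 / 2) * S t\<bar>) \<longlonglongrightarrow> 0"
  proof (rule tendsto_zero_sqrtI[where c = "\<bar>s\<bar>"])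
    fix \<delta> :: real assume \<delta>: "\<delta> > 0"
    obtain K where K: "\<And>i j. i \<le> j \<Longrightarrow>
      \<bar>(\<Sum>k\<in>{i..<j}. mu \<omega> k) - m * real_of_int (j - i)\<bar> \<le> \<delta> * real_of_int (j - i) + K"
      using uniform_mu_sums[OF unif \<delta>] w unfolding m_def by blast
    have d: "\<bar>\<Sum>k\<in>{i..j}. d k\<bar> \<le> \<delta> * real_of_int (j - i + 1) + K" if "i \<le> j" for i j
    proof -
      have eq: "{i..j} = {i..<j + 1}" by auto
      have "(\<Sum>k\<in>{i..j}. d k) = (\<Sum>k\<in>{i..<j + 1}. mu \<omega> k) - m * real_of_int (j + 1 - i)"
        unfolding d_def eq sum_subtractf using that by (simp add: mult.commute)
      then show ?thesis using K[of i "j + 1"] that by (simp add: algebra_simps)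
    qed
    have S: "\<bar>S t\<bar> \<le> \<delta> * (\<bar>s\<bar> * sqrt (real t) + 2) + K" for t
    proof -
      define y where "y = sqrt (real t) * s"
      have fl: "\<lfloor>real (b t) + y\<rfloor> = int (b t) + \<lfloor>y\<rfloor>" "\<lfloor>real (b t)\<rfloor> = int (b t)"
        by linarith simp
      \<comment> \<open>In either direction the sum includes both end points, hence
        \<open>\<bar>\<lfloor>y\<rfloor>\<bar> + 1\<close> sites; rounding adds at most 1 to
        \<open>\<bar>y\<bar>\<close>.\<close>
      have y: "\<bar>real_of_int \<lfloor>y\<rfloor>\<bar> + 1 \<le> \<bar>y\<bar> + 2" by linarith
      have "\<bar>S t\<bar> \<le> \<delta> * (\<bar>real_of_int \<lfloor>y\<rfloor>\<bar> + 1) + K"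
      proof (cases "0 \<le> \<lfloor>y\<rfloor>")
        case True
        then show ?thesis using d[of "int (b t)" "int (b t) + \<lfloor>y\<rfloor>"]
          unfolding S_def real_sum_def y_def[symmetric] fl by simp
      next
        case False
        then show ?thesis using d[of "int (b t) + \<lfloor>y\<rfloor>" "int (b t)"]
          unfolding S_def real_sum_def y_def[symmetric] fl by simp
      qed
      also have "\<delta> * (\<bar>real_of_int \<lfloor>y\<rfloor>\<bar> + 1) \<le> \<delta> * (\<bar>y\<bar> + 2)" using y \<delta> by (intro mult_left_mono) auto
      finally show ?thesis by (simp add: y_def abs_mult mult.commute)
    qed
    show "\<exists>K. \<forall>t\<ge>1. \<bar>real t powr (- 1 / 2) * S t\<bar> \<le> \<delta> * \<bar>s\<bar> + K / sqrt (real t)"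
    proof (intro exI allI impI)
      fix t :: nat assume t: "t \<ge> 1"
      have "real t powr (- 1 / 2) = 1 / sqrt (real t)"
        using t by (simp add: powr_minus_divide powr_half_sqrt)
      then have "\<bar>real t powr (- 1 / 2) * S t\<bar> = \<bar>S t\<bar> / sqrt (real t)" by (simp add: abs_mult)
      also have "\<dots> \<le> (\<delta> * (\<bar>s\<bar> * sqrt (real t) + 2) + K) / sqrt (real t)"
        using S by (intro divide_right_mono) auto
      also have "\<dots> = \<delta> * \<bar>s\<bar> + (2 * \<delta> + K) / sqrt (real t)" using t by (simp add: field_simps)
      finally show "\<bar>real t powr (- 1 / 2) * S t\<bar> \<le> \<delta> * \<bar>s\<bar> + (2 * \<delta> + K) / sqrt (real t)" .
    qed
  qed auto
  then show ?thesis unfolding S_def d_def m_def by (rule tendsto_rabs_zero_cancel)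
qed

text \<open>The exceptional null set comes from the two applications of Birkhoff's theorem behind
  \<open>G_lim\<close>, to \<open>var_series\<close> and to \<open>mu\<close>; the other properties
  hold in every environment.\<close>

lemma (in bounded_environment) AE_centered_walk:
  assumes unif: "uniformly_ergodic_env M T p" and erg: "ergodic M T"
  shows "AE \<omega> in M. centered_walk (P \<omega>) (mu \<omega>) (var_series \<omega>) (B ^ 4)
     (env_mean_mu M T p) (env_sigma2 M T p / env_mean_mu M T p) (\<lambda>t. int (b_tilde M T p \<omega> t))"
proof -
  define m where "m = env_mean_mu M T p"
  define s where "s = env_sigma2 M T p"
  have m: "m > 0" using env_mean_mu_ge by (simp add: m_def)
  have "AE \<omega> in M. (\<lambda>n. (\<Sum>k<n. var_series ((T ^^ k) \<omega>) 0) / real n) \<longlonglongrightarrow> s"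
    unfolding s_def env_sigma2_eq
    by (intro birkhoff prob_space_axioms measurable_T preserving_T erg integrable_var_series)
  moreover have "AE \<omega> in M. (\<lambda>n. (\<Sum>k<n. mu ((T ^^ k) \<omega>) 0) / real n) \<longlonglongrightarrow> m"
    unfolding m_def env_mean_mu_def
    by (intro birkhoff prob_space_axioms measurable_T preserving_T erg integrable_mu)
  ultimately show ?thesis unfolding m_def[symmetric] s_def[symmetric]
  proof (rule AE_mp[OF AE_conjI], intro AE_I2 impI)
    fix \<omega> assume w: "\<omega> \<in> space M" and lim:
      "(\<lambda>n. (\<Sum>k<n. var_series ((T ^^ k) \<omega>) 0) / real n) \<longlonglongrightarrow> s \<and>
       (\<lambda>n. (\<Sum>k<n. mu ((T ^^ k) \<omega>) 0) / real n) \<longlonglongrightarrow> m"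
    interpret drift_walk "P \<omega>" "mu \<omega>" "var_series \<omega>" "B ^ 4" by (rule drift_walk[OF w])
    show "centered_walk (P \<omega>) (mu \<omega>) (var_series \<omega>) (B ^ 4) m (s / m) (\<lambda>t. int (b_tilde M T p \<omega> t))"
    proof
      show "0 < m" "0 < s / m" using m env_sigma2_pos by (auto simp: s_def)
      show "\<exists>K. \<forall>i j. i \<le> j \<longrightarrow>
          \<bar>(\<Sum>k\<in>{i..<j}. mu \<omega> k) - m * real_of_int (j - i)\<bar> \<le> \<delta> * real_of_int (j - i) + K"
        if "0 < \<delta>" for \<delta>
        using uniform_mu_sums[OF unif that] w unfolding m_def by blast
      have "isum (var_series \<omega>) (int n) = (\<Sum>k<n. var_series ((T ^^ k) \<omega>) 0)"
        "isum (mu \<omega>) (int n) = (\<Sum>k<n. mu ((T ^^ k) \<omega>) 0)" for n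
        unfolding isum_of_nat iterate_of_nat[symmetric]
        using var_series_shift[OF w, of 0] mu_shift[OF w, of 0] by simp_all
      then have "(\<lambda>n. (isum (var_series \<omega>) (int n) - s / m * isum (mu \<omega>) (int n)) / real n) \<longlonglongrightarrow> s - s / m * m"
        using tendsto_diff[OF conjunct1[OF lim] tendsto_mult[OF tendsto_const[of "s / m"] conjunct2[OF lim]]]
        by (simp add: diff_divide_distrib)
      then show "(\<lambda>n. (isum (var_series \<omega>) (int n) - s / m * isum (mu \<omega>) (int n)) / real n) \<longlonglongrightarrow> 0"
        using m by simp
      have "B ^ 1 \<le> B ^ 4" using B_ge_1 by (intro power_increasing) auto
      then show "\<bar>isum (mu \<omega>) (int (b_tilde M T p \<omega> t)) - real t\<bar> \<le> B ^ 4" for t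
        using b_tilde_close[OF w, of t] by simp
    qed
  qed
qed

theorem theorem6:
  fixes M :: "'w measure" and T :: "'w \<Rightarrow> 'w" and p :: "'w \<Rightarrow> real"
  assumes env: "random_environment M T p"
    and C': "condition_C' M T p"
    and lambda_neg: "env_lambda M T p < 0"
    and r2: "env_r M T p 2 < 1"
    and unif: "uniformly_ergodic_env M T p"
  shows
    "(AE \<omega> in M. \<forall>x::real.
       (\<lambda>t::nat. real t powr (- 1 / 2) *
          real_sum (\<lambda>k. env_mu M T p \<omega> k - env_mean_mu M T p)
            (real (b_tilde M T p \<omega> t))
            (real (b_tilde M T p \<omega> t) + sqrt (real t) * sigma_star M T p * x))
       \<longlonglongrightarrow> 0)
   \<and> (AE \<omega> in M.
       (\<forall>x::real.
          (\<lambda>t::nat. \<P>(X in walk_law (env_p M T p \<omega>) 0.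
             (real_of_int (X t) - real (b_tilde M T p \<omega> t)) / (sqrt (real t) * sigma_star M T p) \<le> x))
          \<longlonglongrightarrow> Phi x) \<and>
       uniform_limit UNIV
         (\<lambda>(t::nat) (x::real). \<P>(X in walk_law (env_p M T p \<omega>) 0.
             (real_of_int (X t) - real (b_tilde M T p \<omega> t)) / (sqrt (real t) * sigma_star M T p) \<le> x))
         Phi sequentially)"
proof -
  interpret random_environment M T p by (rule env)
  obtain B where "bounded_environment M T p B" using bounded_environment_exists[OF unif] .
  then interpret bounded_environment M T p B .
  have erg: "ergodic M T" using C' by (simp add: condition_C'_def)
  show ?thesis
  proof (intro conjI)
    show "AE \<omega> in M. \<forall>x::real.
       (\<lambda>t::nat. real t powr (- 1 / 2) *
          real_sum (\<lambda>k. env_mu M T p \<omega> k - env_mean_mu M T p)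
            (real (b_tilde M T p \<omega> t))
            (real (b_tilde M T p \<omega> t) + sqrt (real t) * sigma_star M T p * x))
       \<longlonglongrightarrow> 0"
      \<comment> \<open>Here \<open>s\<close> is \<open>sigma_star\<close> times \<open>x\<close>.
        The limit holds in every environment, so all \<open>x\<close> are covered at once.\<close>
      using centering_limit[OF unif] by (intro AE_I2 allI) (simp add: mult.assoc)
    show "AE \<omega> in M.
       (\<forall>x::real.
          (\<lambda>t::nat. \<P>(X in walk_law (env_p M T p \<omega>) 0.
             (real_of_int (X t) - real (b_tilde M T p \<omega> t)) / (sqrt (real t) * sigma_star M T p) \<le> x))
          \<longlonglongrightarrow> Phi x) \<and>
       uniform_limit UNIV
         (\<lambda>(t::nat) (x::real). \<P>(X in walk_law (env_p M T p \<omega>) 0.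
             (real_of_int (X t) - real (b_tilde M T p \<omega> t)) / (sqrt (real t) * sigma_star M T p) \<le> x))
         Phi sequentially"
      using AE_centered_walk[OF unif erg]
    proof eventually_elim
      case (elim \<omega>)
      interpret centered_walk "P \<omega>" "mu \<omega>" "var_series \<omega>" "B ^ 4" "env_mean_mu M T p"
        "env_sigma2 M T p / env_mean_mu M T p" "\<lambda>t. int (b_tilde M T p \<omega> t)" by (rule elim)
      show ?case using clt by (simp add: sigma_star_eq space_PiM)
    qed
  qed
qed

end
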